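(* There is an algorithm that, given a graph $G$ on $n$ vertices and an integer $k$, decides whether $G$ has a $b$-coloring with $k$ colors in time $2^{\mathcal{O}(\ell^2\log \ell)}\cdot n^{\mathcal{O}(1)}$, where $\ell$ is the vertex cover number of $G$.
   Context: All graphs are finite and simple. A vertex cover of $G$ is a set $S\subseteq V(G)$ such that $V(G)\setminus S$ is an independent set; the vertex cover number is the minimum size of a vertex cover. A $k$-coloring of $G$ is an ordered partition $(C_1,\ldots,C_k)$ of $V(G)$; it is proper if every $C_i$ is independent. A proper coloring $(C_1,\ldots,C_k)$ is a $b$-coloring if for every $i$ there is a vertex $v_i\in C_i$ having a neighbor in $C_j$ for every $j\neq i$. *)

theory Defs
  imports
    Complex_Main
    "HOL-Library.Disjoint_Sets"
    "HOL-Library.Landau_Symbols"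
    "Graph_Theory.Pair_Digraph"
begin

section \<open>Vertex covers and b-colorings\<close>

text \<open>
  Finite simple graphs are the graphs \<open>G\<close> with \<open>pair_graph G\<close>: finite, symmetric and
  loop-free arc relations, without parallel arcs.
\<close>

definition independent_set :: "'a pair_pre_digraph \<Rightarrow> 'a set \<Rightarrow> bool" where
  "independent_set G S \<longleftrightarrow> S \<subseteq> pverts G \<and> (\<forall>u\<in>S. \<forall>v\<in>S. (u, v) \<notin> parcs G)"

definition vertex_cover :: "'a pair_pre_digraph \<Rightarrow> 'a set \<Rightarrow> bool" where
  "vertex_cover G S \<longleftrightarrow> S \<subseteq> pverts G \<and> independent_set G (pverts G - S)"

definition vertex_cover_number :: "'a pair_pre_digraph \<Rightarrow> nat" where
  "vertex_cover_number G = Min {card S | S. vertex_cover G S}"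

text \<open>
  An ordered partition into \<open>k\<close> classes is a family of sets indexed by \<open>{1..k}\<close>. Empty classes
  are not excluded here; a b-coloring has none.
\<close>

definition coloring :: "'a pair_pre_digraph \<Rightarrow> nat \<Rightarrow> (nat \<Rightarrow> 'a set) \<Rightarrow> bool" where
  "coloring G k C \<longleftrightarrow> (\<Union>i\<in>{1..k}. C i) = pverts G \<and> disjoint_family_on C {1..k}"

definition proper_coloring :: "'a pair_pre_digraph \<Rightarrow> nat \<Rightarrow> (nat \<Rightarrow> 'a set) \<Rightarrow> bool" where
  "proper_coloring G k C \<longleftrightarrow> coloring G k C \<and> (\<forall>i\<in>{1..k}. independent_set G (C i))"

definition b_coloring :: "'a pair_pre_digraph \<Rightarrow> nat \<Rightarrow> (nat \<Rightarrow> 'a set) \<Rightarrow> bool" where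
  "b_coloring G k C \<longleftrightarrow> proper_coloring G k C \<and>
     (\<forall>i\<in>{1..k}. \<exists>v\<in>C i. \<forall>j\<in>{1..k} - {i}. \<exists>w\<in>C j. (v, w) \<in> parcs G)"

section \<open>Random access machine programs\<close>

text \<open>
  The model of computation is the unit-cost random access machine on natural numbers with
  addition and truncated subtraction, programmed with structured control flow. There is no
  multiplication, so a step lengthens the largest stored number by at most one bit, and the
  model is polynomially equivalent to Turing machines.

  A state consists of the registers (a program mentions only finitely many of them) and the
  memory, which is accessed through addresses held in registers.
\<close>

type_synonym reg = nat
type_synonym state = "(reg \<Rightarrow> nat) \<times> (nat \<Rightarrow> nat)"

datatype com =
    Const reg nat        \<comment> \<open>\<open>R\<^sub>x := c\<close>\<close>
  | Add reg reg reg      \<comment> \<open>\<open>R\<^sub>x := R\<^sub>y + R\<^sub>z\<close>\<close>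
  | Sub reg reg reg      \<comment> \<open>\<open>R\<^sub>x := R\<^sub>y - R\<^sub>z\<close>, truncated at 0\<close>
  | Load reg reg         \<comment> \<open>\<open>R\<^sub>x := M[R\<^sub>y]\<close>\<close>
  | Store reg reg        \<comment> \<open>\<open>M[R\<^sub>x] := R\<^sub>y\<close>\<close>
  | Seq com com
  | If reg com com       \<comment> \<open>the first branch is taken if \<open>R\<^sub>x\<close> is nonzero\<close>
  | While reg com        \<comment> \<open>loops as long as \<open>R\<^sub>x\<close> is nonzero\<close>

text \<open>\<open>exec c s t s'\<close>: started in \<open>s\<close>, the program \<open>c\<close> halts in \<open>s'\<close> after exactly \<open>t\<close> steps.\<close>

inductive exec :: "com \<Rightarrow> state \<Rightarrow> nat \<Rightarrow> state \<Rightarrow> bool" where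
  Const: "exec (Const x c) (R, M) 1 (R(x := c), M)"
| Add: "exec (Add x y z) (R, M) 1 (R(x := R y + R z), M)"
| Sub: "exec (Sub x y z) (R, M) 1 (R(x := R y - R z), M)"
| Load: "exec (Load x y) (R, M) 1 (R(x := M (R y)), M)"
| Store: "exec (Store x y) (R, M) 1 (R, M(R x := R y))"
| Seq: "exec c1 s1 t1 s2 \<Longrightarrow> exec c2 s2 t2 s3 \<Longrightarrow> exec (Seq c1 c2) s1 (t1 + t2) s3"
| IfTrue: "fst s x \<noteq> 0 \<Longrightarrow> exec c1 s t s' \<Longrightarrow> exec (If x c1 c2) s (1 + t) s'"
| IfFalse: "fst s x = 0 \<Longrightarrow> exec c2 s t s' \<Longrightarrow> exec (If x c1 c2) s (1 + t) s'"
| WhileFalse: "fst s x = 0 \<Longrightarrow> exec (While x c) s 1 s"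
| WhileTrue: "fst s1 x \<noteq> 0 \<Longrightarrow> exec c s1 t1 s2 \<Longrightarrow> exec (While x c) s2 t2 s3 \<Longrightarrow>
    exec (While x c) s1 (1 + t1 + t2) s3"

inductive_cases exec_ConstE: "exec (Const x c) s t s'"
inductive_cases exec_AddE: "exec (Add x y z) s t s'"
inductive_cases exec_SubE: "exec (Sub x y z) s t s'"
inductive_cases exec_LoadE: "exec (Load x y) s t s'"
inductive_cases exec_StoreE: "exec (Store x y) s t s'"
inductive_cases exec_SeqE: "exec (Seq c1 c2) s t s'"
inductive_cases exec_IfE: "exec (If x c1 c2) s t s'"
inductive_cases exec_WhileE: "exec (While x c) s t s'"

lemma exec_deterministic:
  "exec c s t s' \<Longrightarrow> exec c s u s'' \<Longrightarrow> t = u \<and> s' = s''"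
proof (induction arbitrary: u s'' rule: exec.induct)
  case (Seq c1 s1 t1 s2 c2 t2 s3)
  from Seq.prems obtain u1 u2 r where u: "u = u1 + u2" "exec c1 s1 u1 r" "exec c2 r u2 s''"
    by (rule exec_SeqE)
  from Seq.IH(1)[OF u(2)] u(3) have "exec c2 s2 u2 s''" by simp
  from Seq.IH(2)[OF this] Seq.IH(1)[OF u(2)] u(1) show ?case by simp
next
  case (IfTrue s x c1 t s' c2)
  from IfTrue.prems show ?case by (rule exec_IfE) (simp_all add: IfTrue.IH IfTrue.hyps)
next
  case (IfFalse s x c2 t s' c1)
  from IfFalse.prems show ?case by (rule exec_IfE) (simp_all add: IfFalse.IH IfFalse.hyps)
next
  case (WhileFalse s x c)
  from WhileFalse.prems show ?case by (rule exec_WhileE) (simp_all add: WhileFalse.hyps)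
next
  case (WhileTrue s1 x c t1 s2 t2 s3)
  from WhileTrue.prems obtain u1 u2 r
    where u: "u = 1 + u1 + u2" "exec c s1 u1 r" "exec (While x c) r u2 s''"
    by (rule exec_WhileE) (use WhileTrue.hyps(1) in auto)
  from WhileTrue.IH(1)[OF u(2)] u(3) have "exec (While x c) s2 u2 s''" by simp
  from WhileTrue.IH(2)[OF this] WhileTrue.IH(1)[OF u(2)] u(1) show ?case by simp
qed (erule exec_ConstE exec_AddE exec_SubE exec_LoadE exec_StoreE, simp)+

text \<open>
  An input graph has vertex set \<open>{..<n}\<close>. Registers 0 and 1 initially hold \<open>n\<close> and \<open>k\<close>, and the
  first \<open>n * n\<close> memory cells hold the adjacency matrix row by row; everything else is 0.
\<close>

definition input_state :: "nat pair_pre_digraph \<Rightarrow> nat \<Rightarrow> state" where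
  "input_state G k =
     (let n = card (pverts G) in
       ((\<lambda>_. 0)(0 := n, 1 := k),
        \<lambda>a. if a < n * n \<and> (a div n, a mod n) \<in> parcs G then 1 else 0))"

text \<open>The answer is read off register 0: 1 for yes, 0 for no.\<close>

definition halts_with :: "com \<Rightarrow> state \<Rightarrow> nat \<Rightarrow> bool \<Rightarrow> bool" where
  "halts_with p s t b \<longleftrightarrow> (\<exists>s'. exec p s t s' \<and> fst s' 0 = (if b then 1 else 0))"

end

theory Submission
  imports Defs "HOL-Real_Asymp.Real_Asymp"
begin

text \<open>
  Let \<open>S\<close> be the set of ends of a greedy maximal matching, a vertex cover of size \<open>l\<close> at most twice
  the minimum. A b-coloring has at most \<open>l + 1\<close> colors: of two colors missing \<open>S\<close>, the b-vertex of one
  would have a neighbor in the other, an edge outside \<open>S\<close>.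

  Guess the colors of \<open>S\<close> and, for every color \<open>j\<close>, a partition of the cover vertices that have a
  neighbor of color \<open>j\<close> outside \<open>S\<close>, according to one such neighbor. A group can be served by any
  vertex adjacent to all of it that sees no color \<open>j\<close> in \<open>S\<close>. There are only \<open>m = O(l\<^sup>2)\<close> groups, so by
  exchange distinct serving vertices can be found among the first \<open>m\<close> candidates of each group, and
  their ranks are guessed too. A guess thus consists of \<open>O(l\<^sup>2)\<close> digits of size \<open>O(l\<^sup>2)\<close>, coded as one
  number below \<open>P = 2 ^ O(l\<^sup>2 log l)\<close>.

  The program evaluates one expression built from sums over ranges of length at most polynomial in
  \<open>n * P\<close>, so its running time is polynomial in \<open>n * P\<close> by induction on the expression.
\<close>

section \<open>Running programs within a time bound\<close>

text \<open>A digit must range over a set bounded in terms of \<open>l\<close> alone. Naming a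
  serving vertex directly would cost a factor \<open>n\<close> for every group, hence
  \<open>n ^ O(l ^ 2)\<close> in all; a bounded rank costs only a factor polynomial in
  \<open>l\<close>. The obstacle is that a vertex outside \<open>S\<close> has one color only, so
  the groups of all colors compete for serving vertices. This is a matching problem, but with
  guessed ranks it need not be solved: the check merely tests that no vertex is chosen for two
  colors. A color needs at most \<open>l + 1\<close> groups, one for each cover vertex and one more
  for a b-vertex outside \<open>S\<close>. The neighbors of such a b-vertex all lie in
  \<open>S\<close>; if each of them names it as its serving vertex, its group is its whole
  neighborhood. Whatever replaces it is then adjacent to all those neighbors and is again a
  b-vertex. With \<open>l\<close> digits for the cover this makes \<open>l + k * (2 * l + 1)\<close>
  digits.\<close>

definition runs :: "com \<Rightarrow> state \<Rightarrow> nat \<Rightarrow> (state \<Rightarrow> bool) \<Rightarrow> bool" where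
  "runs c s T Q \<longleftrightarrow> (\<exists>t s'. exec c s t s' \<and> t \<le> T \<and> Q s')"

lemma runs_conseq: "runs c s T Q \<Longrightarrow> T \<le> T' \<Longrightarrow> (\<And>s'. Q s' \<Longrightarrow> Q' s') \<Longrightarrow> runs c s T' Q'"
  unfolding runs_def by (meson le_trans)

lemma runs_Const: "Q (R(x := c), M) \<Longrightarrow> runs (Const x c) (R, M) 1 Q"
  unfolding runs_def using exec.Const by blast

lemma runs_Add: "Q (R(x := R y + R z), M) \<Longrightarrow> runs (Add x y z) (R, M) 1 Q"
  unfolding runs_def using exec.Add by blast

lemma runs_Sub: "Q (R(x := R y - R z), M) \<Longrightarrow> runs (Sub x y z) (R, M) 1 Q"
  unfolding runs_def using exec.Sub by blast

lemma runs_Load: "Q (R(x := M (R y)), M) \<Longrightarrow> runs (Load x y) (R, M) 1 Q"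
  unfolding runs_def using exec.Load by blast

lemma runs_Store: "Q (R, M(R x := R y)) \<Longrightarrow> runs (Store x y) (R, M) 1 Q"
  unfolding runs_def using exec.Store by blast

text \<open>The postcondition of the first command is that the second one runs from there. A
  sequence is thus verified forwards, one command at a time, without intermediate
  assertions.\<close>

lemma runs_Seq:
  assumes "runs c1 s T1 (\<lambda>s'. runs c2 s' T2 Q)"
  shows "runs (Seq c1 c2) s (T1 + T2) Q"
  using assms unfolding runs_def by (meson exec.Seq add_mono)

lemma runs_If:
  assumes "R x \<noteq> 0 \<Longrightarrow> runs c1 (R, M) T1 Q" "R x = 0 \<Longrightarrow> runs c2 (R, M) T2 Q"
  shows "runs (If x c1 c2) (R, M) (1 + T1 + T2) Q"
proof (cases "R x = 0")
  case True
  then obtain t s' where "exec c2 (R, M) t s'" "t \<le> T2" "Q s'"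
    using assms(2) unfolding runs_def by blast
  then show ?thesis unfolding runs_def
    by (intro exI[of _ "1 + t"] exI[of _ s']) (auto intro: exec.IfFalse simp: True simp del: One_nat_def plus_1_eq_Suc)
next
  case False
  then obtain t s' where "exec c1 (R, M) t s'" "t \<le> T1" "Q s'"
    using assms(1) unfolding runs_def by blast
  then show ?thesis unfolding runs_def
    using False by (intro exI[of _ "1 + t"] exI[of _ s']) (use exec.IfTrue[of "(R, M)" x] in auto)
qed

text \<open>The invariant is indexed by the number of rounds done and forces exactly
  \<open>N\<close> rounds, so an induction on the rounds still to come suffices. Each round pays one
  step for its test, and the final failing test is the last \<open>+ 1\<close>.\<close>

lemma runs_While:
  assumes step: "\<And>i s. i < N \<Longrightarrow> I i s \<Longrightarrow> fst s y \<noteq> 0 \<and> runs c s T (I (Suc i))"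
    and stop: "\<And>s. I N s \<Longrightarrow> fst s y = 0"
    and init: "I 0 s"
  shows "runs (While y c) s (N * (T + 1) + 1) (I N)"
proof -
  have "I (N - m) s \<Longrightarrow> m \<le> N \<Longrightarrow> runs (While y c) s (m * (T + 1) + 1) (I N)" for m s
  proof (induction m arbitrary: s)
    case 0
    then show ?case unfolding runs_def
      by (intro exI[of _ 1] exI[of _ s]) (auto intro: exec.WhileFalse stop simp del: One_nat_def)
  next
    case (Suc m)
    from step[OF _ Suc.prems(1)] Suc.prems(2) obtain t s'
      where 1: "fst s y \<noteq> 0" "exec c s t s'" "t \<le> T" "I (N - m) s'"
      unfolding runs_def by (auto simp: Suc_diff_Suc)
    from Suc.IH[OF 1(4)] Suc.prems(2) obtain t' s''
      where 2: "exec (While y c) s' t' s''" "t' \<le> m * (T + 1) + 1" "I N s''"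
      unfolding runs_def by auto
    show ?case unfolding runs_def
      using exec.WhileTrue[OF 1(1,2) 2(1)] 1(3) 2(2,3)
      by (intro exI[of _ "1 + t + t'"] exI[of _ s'']) auto
  qed
  from this[of N s] init show ?thesis by simp
qed

section \<open>Expressions with bounded sums\<close>

datatype ex =
    Lit nat
  | Var reg
  | Plus ex ex
  | Minus ex ex
  | Cell ex
  | Cond ex ex ex
  | Bind reg ex ex
  | Total reg reg ex

fun ev :: "ex \<Rightarrow> (reg \<Rightarrow> nat) \<Rightarrow> (nat \<Rightarrow> nat) \<Rightarrow> nat" where
  "ev (Lit c) R M = c"
| "ev (Var x) R M = R x"
| "ev (Plus a b) R M = ev a R M + ev b R M"
| "ev (Minus a b) R M = ev a R M - ev b R M"
| "ev (Cell a) R M = M (ev a R M)"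
| "ev (Cond c a b) R M = (if ev c R M \<noteq> 0 then ev a R M else ev b R M)"
| "ev (Bind x a b) R M = ev b (R(x := ev a R M)) M"
| "ev (Total x b a) R M = (\<Sum>i<R b. ev a (R(x := i)) M)"

text \<open>
  The bound of a sum must be held in a register below 8 other than register 1, whose content, the
  input \<open>k\<close>, is not bounded in terms of the graph. Binders use registers from 12 on, so bounds stay
  fixed during evaluation. Registers from 40 on are reserved for intermediate results.
\<close>

definition bound_reg :: "reg \<Rightarrow> bool" where
  "bound_reg b \<longleftrightarrow> b < 8 \<and> b \<noteq> 1"

fun wf_ex :: "ex \<Rightarrow> bool" where
  "wf_ex (Lit c) \<longleftrightarrow> True"
| "wf_ex (Var x) \<longleftrightarrow> x < 40"
| "wf_ex (Plus a b) \<longleftrightarrow> wf_ex a \<and> wf_ex b"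
| "wf_ex (Minus a b) \<longleftrightarrow> wf_ex a \<and> wf_ex b"
| "wf_ex (Cell a) \<longleftrightarrow> wf_ex a"
| "wf_ex (Cond c a b) \<longleftrightarrow> wf_ex c \<and> wf_ex a \<and> wf_ex b"
| "wf_ex (Bind x a b) \<longleftrightarrow> 12 \<le> x \<and> x < 40 \<and> wf_ex a \<and> wf_ex b"
| "wf_ex (Total x b a) \<longleftrightarrow> 12 \<le> x \<and> x < 40 \<and> bound_reg b \<and> wf_ex a"

text \<open>Compiled code uses registers from 40 on as scratch space; this lemma makes the value of
  an expression insensitive to what earlier evaluations left there.\<close>

lemma ev_cong: "wf_ex e \<Longrightarrow> (\<And>x. x < 40 \<Longrightarrow> R x = R' x) \<Longrightarrow> ev e R M = ev e R' M"
proof (induction e arbitrary: R R')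
  case (Cond c a b)
  have "ev c R M = ev c R' M" "ev a R M = ev a R' M" "ev b R M = ev b R' M"
    using Cond.prems by (auto intro!: Cond.IH)
  then show ?case by simp
next
  case (Bind x a b)
  have "ev a R M = ev a R' M" by (rule Bind.IH(1)) (use Bind.prems in auto)
  moreover have "ev b (R(x := i)) M = ev b (R'(x := i)) M" for i
    by (rule Bind.IH(2)) (use Bind.prems in auto)
  ultimately show ?case by simp
next
  case (Total x b a)
  have "ev a (R(x := i)) M = ev a (R'(x := i)) M" for i
    by (rule Total.IH) (use Total.prems in auto)
  moreover have "R b = R' b" using Total.prems by (simp add: bound_reg_def)
  ultimately show ?case by simp
next
  case (Plus a b)
  have "ev a R M = ev a R' M" "ev b R M = ev b R' M"
    using Plus.prems by (auto intro!: Plus.IH)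
  then show ?case by simp
next
  case (Minus a b)
  have "ev a R M = ev a R' M" "ev b R M = ev b R' M"
    using Minus.prems by (auto intro!: Minus.IH)
  then show ?case by simp
next
  case (Cell a)
  have "ev a R M = ev a R' M" using Cell.prems by (auto intro!: Cell.IH)
  then show ?case by simp
qed auto

definition copy :: "reg \<Rightarrow> reg \<Rightarrow> com" where
  "copy x y = Seq (Const x 0) (Add x x y)"

lemma runs_copy: "Q (R(x := R y), M) \<Longrightarrow> x \<noteq> y \<Longrightarrow> runs (copy x y) (R, M) 2 Q"
  unfolding copy_def one_add_one[symmetric]
  by (intro runs_Seq runs_Const runs_Add) (simp add: fun_upd_def if_distrib cong: if_cong)

text \<open>The result goes to register \<open>d\<close>; all registers below \<open>d\<close> are restored.\<close>

fun compile :: "nat \<Rightarrow> ex \<Rightarrow> com" where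
  "compile d (Lit c) = Const d c"
| "compile d (Var x) = copy d x"
| "compile d (Plus a b) = Seq (compile d a) (Seq (compile (d+1) b) (Add d d (d+1)))"
| "compile d (Minus a b) = Seq (compile d a) (Seq (compile (d+1) b) (Sub d d (d+1)))"
| "compile d (Cell a) = Seq (compile d a) (Load d d)"
| "compile d (Cond c a b) = Seq (compile d c) (If d (compile d a) (compile d b))"
| "compile d (Bind x a b) =
    Seq (compile d a) (Seq (copy (d+1) x) (Seq (copy x d)
      (Seq (compile (d+2) b) (Seq (copy d (d+2)) (copy x (d+1))))))"
| "compile d (Total x b a) =
    Seq (Const d 0) (Seq (copy (d+1) x) (Seq (copy (d+2) b) (Seq (Const (d+3) 1) (Seq (Const x 0)
     (Seq (While (d+2) (Seq (compile (d+4) a) (Seq (Add d d (d+4))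
             (Seq (Add x x (d+3)) (Sub (d+2) (d+2) (d+3))))))
       (copy x (d+1)))))))"

text \<open>The sums are bracketed like the \<open>Seq\<close> structure of \<open>compile\<close>,
  so that \<open>runs_Seq\<close> produces these bounds by unification. A conditional pays for both
  branches, which keeps the bound a sum.\<close>

fun ex_time :: "ex \<Rightarrow> nat \<Rightarrow> nat" where
  "ex_time (Lit c) X = 1"
| "ex_time (Var x) X = 2"
| "ex_time (Plus a b) X = ex_time a X + (ex_time b X + 1)"
| "ex_time (Minus a b) X = ex_time a X + (ex_time b X + 1)"
| "ex_time (Cell a) X = ex_time a X + 1"
| "ex_time (Cond c a b) X = ex_time c X + (1 + ex_time a X + ex_time b X)"
| "ex_time (Bind x a b) X = ex_time a X + (2 + (2 + (ex_time b X + (2 + 2))))"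
| "ex_time (Total x b a) X =
    1 + (2 + (2 + (1 + (1 + ((X * ((ex_time a X + (1 + (1 + 1))) + 1) + 1) + 2)))))"

definition bounded :: "nat \<Rightarrow> (reg \<Rightarrow> nat) \<Rightarrow> bool" where
  "bounded X R \<longleftrightarrow> (\<forall>b. bound_reg b \<longrightarrow> R b \<le> X)"

lemma bounded_cong: "bounded X R \<Longrightarrow> (\<And>x. x < 12 \<Longrightarrow> R' x = R x) \<Longrightarrow> bounded X R'"
  unfolding bounded_def bound_reg_def by fastforce

text \<open>Register \<open>d\<close> acts as a stack pointer. The frame condition below
  \<open>d\<close> keeps a first operand alive while the second is evaluated above it, and it keeps
  the registers that hold sum bounds fixed, so \<open>bounded\<close> passes on to every
  subexpression.\<close>

lemma runs_compile:
  assumes "wf_ex e" "40 \<le> d" "bounded X R"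
    and "\<And>R'. R' d = ev e R M \<Longrightarrow> (\<And>x. x < d \<Longrightarrow> R' x = R x) \<Longrightarrow> Q (R', M)"
  shows "runs (compile d e) (R, M) (ex_time e X) Q"
  using assms
proof (induction e arbitrary: d R Q)
  case (Lit c)
  show ?case unfolding compile.simps ex_time.simps by (rule runs_Const) (auto intro: Lit.prems(4))
next
  case (Var x)
  show ?case using Var.prems(1,2) by (auto intro!: runs_copy Var.prems(4))
next
  case (Plus a b)
  have wf: "wf_ex a" "wf_ex b" and d: "40 \<le> d" and bd: "bounded X R"
    using Plus.prems(1-3) by auto
  show ?case unfolding compile.simps ex_time.simps
  proof (rule runs_Seq, rule Plus.IH(1)[OF wf(1) d bd])
    fix R1 assume R1: "R1 d = ev a R M" "\<And>x. x < d \<Longrightarrow> R1 x = R x"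
    have b: "ev b R1 M = ev b R M"
      by (rule ev_cong[OF wf(2)]) (use R1(2) d in simp)
    have bd1: "bounded X R1" by (rule bounded_cong[OF bd]) (use R1(2) d in simp)
    show "runs (Seq (compile (d + 1) b) (Add d d (d + 1))) (R1, M) (ex_time b X + 1) Q"
    proof (rule runs_Seq, rule Plus.IH(2)[OF wf(2) _ bd1])
      fix R2 assume R2: "R2 (d + 1) = ev b R1 M" "\<And>x. x < d + 1 \<Longrightarrow> R2 x = R1 x"
      show "runs (Add d d (d + 1)) (R2, M) 1 Q"
        by (rule runs_Add, rule Plus.prems(4)) (use R1 R2 b in simp_all)
    qed (use d in simp)
  qed
next
  case (Minus a b)
  have wf: "wf_ex a" "wf_ex b" and d: "40 \<le> d" and bd: "bounded X R"
    using Minus.prems(1-3) by auto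
  show ?case unfolding compile.simps ex_time.simps
  proof (rule runs_Seq, rule Minus.IH(1)[OF wf(1) d bd])
    fix R1 assume R1: "R1 d = ev a R M" "\<And>x. x < d \<Longrightarrow> R1 x = R x"
    have b: "ev b R1 M = ev b R M"
      by (rule ev_cong[OF wf(2)]) (use R1(2) d in simp)
    have bd1: "bounded X R1" by (rule bounded_cong[OF bd]) (use R1(2) d in simp)
    show "runs (Seq (compile (d + 1) b) (Sub d d (d + 1))) (R1, M) (ex_time b X + 1) Q"
    proof (rule runs_Seq, rule Minus.IH(2)[OF wf(2) _ bd1])
      fix R2 assume R2: "R2 (d + 1) = ev b R1 M" "\<And>x. x < d + 1 \<Longrightarrow> R2 x = R1 x"
      show "runs (Sub d d (d + 1)) (R2, M) 1 Q"
        by (rule runs_Sub, rule Minus.prems(4)) (use R1 R2 b in simp_all)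
    qed (use d in simp)
  qed
next
  case (Cell a)
  have wf: "wf_ex a" and d: "40 \<le> d" and bd: "bounded X R"
    using Cell.prems(1-3) by auto
  show ?case unfolding compile.simps ex_time.simps
    by (rule runs_Seq, rule Cell.IH[OF wf d bd], rule runs_Load, rule Cell.prems(4)) simp_all
next
  case (Cond c a b)
  have wf: "wf_ex c" "wf_ex a" "wf_ex b" and d: "40 \<le> d" and bd: "bounded X R"
    using Cond.prems(1-3) by auto
  show ?case unfolding compile.simps ex_time.simps
  proof (rule runs_Seq, rule Cond.IH(1)[OF wf(1) d bd])
    fix R1 assume R1: "R1 d = ev c R M" "\<And>x. x < d \<Longrightarrow> R1 x = R x"
    have ab: "ev a R1 M = ev a R M" "ev b R1 M = ev b R M"
      by (rule ev_cong; use R1(2) d wf in simp)+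
    have bd1: "bounded X R1" by (rule bounded_cong[OF bd]) (use R1(2) d in simp)
    show "runs (If d (compile d a) (compile d b)) (R1, M) (1 + ex_time a X + ex_time b X) Q"
    proof (rule runs_If)
      assume "R1 d \<noteq> 0"
      then show "runs (compile d a) (R1, M) (ex_time a X) Q"
        using R1 ab by (intro Cond.IH(2)[OF wf(2) d bd1] Cond.prems(4)) simp_all
    next
      assume "R1 d = 0"
      then show "runs (compile d b) (R1, M) (ex_time b X) Q"
        using R1 ab by (intro Cond.IH(3)[OF wf(3) d bd1] Cond.prems(4)) simp_all
    qed
  qed
next
  case (Bind x a b)
  have x: "12 \<le> x" "x < 40" and wf: "wf_ex a" "wf_ex b" and d: "40 \<le> d" and bd: "bounded X R"
    using Bind.prems(1-3) by auto
  show ?case unfolding compile.simps ex_time.simps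
  proof (rule runs_Seq, rule Bind.IH(1)[OF wf(1) d bd])
    fix R1 assume R1: "R1 d = ev a R M" "\<And>x. x < d \<Longrightarrow> R1 x = R x"
    let ?R2 = "(R1(d + 1 := R1 x))(x := R1 d)"
    have b: "ev b ?R2 M = ev b (R(x := ev a R M)) M"
      by (rule ev_cong[OF wf(2)]) (use R1 d in simp)
    have bd2: "bounded X ?R2" by (rule bounded_cong[OF bd]) (use R1 d x in simp)
    have *: "runs (compile (d + 2) b) (?R2, M) (ex_time b X)
        (\<lambda>s'. runs (Seq (copy d (d + 2)) (copy x (d + 1))) s' (2 + 2) Q)"
    proof (rule Bind.IH(2)[OF wf(2) _ bd2])
      fix R3 assume R3: "R3 (d + 2) = ev b ?R2 M" "\<And>y. y < d + 2 \<Longrightarrow> R3 y = ?R2 y"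
      show "runs (Seq (copy d (d + 2)) (copy x (d + 1))) (R3, M) (2 + 2) Q"
        by (rule runs_Seq, rule runs_copy, rule runs_copy, rule Bind.prems(4))
          (use R3 b R1 x d in simp_all)
    qed (use d in simp)
    show "runs (Seq (copy (d + 1) x) (Seq (copy x d) (Seq (compile (d + 2) b)
        (Seq (copy d (d + 2)) (copy x (d + 1)))))) (R1, M) (2 + (2 + (ex_time b X + (2 + 2)))) Q"
      by (rule runs_Seq, rule runs_copy, rule runs_Seq, rule runs_copy, rule runs_Seq)
        (use * x d in simp_all)
  qed
next
  case (Total x b a)
  have x: "12 \<le> x" "x < 40" and b: "b < 8" "bound_reg b" and wf: "wf_ex a"
    and d: "40 \<le> d" and bd: "bounded X R"
    using Total.prems(1-3) by (auto simp: bound_reg_def)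
  have N: "R b \<le> X" using bd b by (auto simp: bounded_def)
  let ?f = "\<lambda>i. ev a (R(x := i)) M"
  \<comment> \<open>Register \<open>d\<close> accumulates the sum, \<open>d+1\<close> saves the
    outer value of the bound variable, \<open>d+2\<close> counts the remaining rounds down to the
    loop exit, and \<open>d+3\<close> holds the constant 1, since the machine adds and subtracts
    registers only.\<close>
  define I where "I i s \<longleftrightarrow> (\<exists>R'. s = (R', M) \<and> R' d = (\<Sum>j<i. ?f j) \<and> R' (d+1) = R x \<and>
      R' (d+2) = R b - i \<and> R' (d+3) = 1 \<and> R' x = i \<and> (\<forall>y<d. y \<noteq> x \<longrightarrow> R' y = R y))" for i s
  let ?c = "Seq (compile (d+4) a) (Seq (Add d d (d+4)) (Seq (Add x x (d+3)) (Sub (d+2) (d+2) (d+3))))"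
  let ?T = "ex_time a X + (1 + (1 + 1))"
  have step: "runs ?c s ?T (I (Suc i))" and ne: "fst s (d+2) \<noteq> 0" if i: "i < R b" and "I i s" for i s
  proof -
    obtain R' where s: "s = (R', M)" and R': "R' d = (\<Sum>j<i. ?f j)" "R' (d+1) = R x"
      "R' (d+2) = R b - i" "R' (d+3) = 1" "R' x = i" "\<And>y. y < d \<Longrightarrow> y \<noteq> x \<Longrightarrow> R' y = R y"
      using \<open>I i s\<close> unfolding I_def by auto
    show "fst s (d+2) \<noteq> 0" using i R'(3) s by simp
    have e: "ev a R' M = ?f i" by (rule ev_cong[OF wf]) (use R'(5,6) d in simp)
    have bd': "bounded X R'" by (rule bounded_cong[OF bd]) (use R'(6) d x in simp)
    show "runs ?c s ?T (I (Suc i))" unfolding s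
    proof (rule runs_Seq, rule Total.IH[OF wf _ bd'])
      fix R2 assume R2: "R2 (d + 4) = ev a R' M" "\<And>y. y < d + 4 \<Longrightarrow> R2 y = R' y"
      show "runs (Seq (Add d d (d + 4)) (Seq (Add x x (d + 3)) (Sub (d + 2) (d + 2) (d + 3))))
         (R2, M) (1 + (1 + 1)) (I (Suc i))"
        by (rule runs_Seq, rule runs_Add, rule runs_Seq, rule runs_Add, rule runs_Sub)
          (use R2 R' e x d i in \<open>simp add: I_def\<close>)
    qed (use d in simp)
  qed
  have fin: "runs (copy x (d + 1)) s 2 Q" if I: "I (R b) s" for s
  proof -
    obtain R' where s: "s = (R', M)" and R': "R' d = (\<Sum>j<R b. ?f j)" "R' (d+1) = R x"
      "\<And>y. y < d \<Longrightarrow> y \<noteq> x \<Longrightarrow> R' y = R y"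
      using I unfolding I_def by auto
    show ?thesis unfolding s
      by (rule runs_copy, rule Total.prems(4)) (use R' x d in simp_all)
  qed
  have loop: "runs (While (d+2) ?c) (R0, M) (X * (?T + 1) + 1) (\<lambda>s. runs (copy x (d + 1)) s 2 Q)"
    if "I 0 (R0, M)" for R0
  proof (rule runs_conseq)
    show "runs (While (d+2) ?c) (R0, M) (R b * (?T + 1) + 1) (I (R b))"
    proof (rule runs_While)
      show "fst s (d + 2) \<noteq> 0 \<and> runs ?c s ?T (I (Suc i))" if "i < R b" "I i s" for i s
        using step[OF that] ne[OF that] by blast
      show "fst s (d + 2) = 0" if "I (R b) s" for s
        using that by (auto simp: I_def)
    qed fact
    show "R b * (?T + 1) + 1 \<le> X * (?T + 1) + 1"
      by (intro add_mono mult_le_mono N order_refl)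
  qed (rule fin)
  have init: "I 0 (R(d := 0, d+1 := R x, d+2 := R b, d+3 := 1, x := 0), M)"
    unfolding I_def
    by (rule exI[of _ "R(d := 0, d+1 := R x, d+2 := R b, d+3 := 1, x := 0)"]) (use x b d in simp)
  have eqs: "(R(d := 0)) x = R x" "(R(d := 0, d+1 := R x)) b = R b"
    using x b d by simp_all
  show ?case unfolding compile.simps ex_time.simps
    apply (rule runs_Seq, rule runs_Const, rule runs_Seq, rule runs_copy, unfold eqs)
     apply (rule runs_Seq, rule runs_copy, unfold eqs)
      apply (rule runs_Seq, rule runs_Const, rule runs_Seq, rule runs_Const, rule runs_Seq)
      apply (rule loop, rule init)
    using x b d by simp_all
qed

section \<open>Assignments, stores and counted loops\<close>

definition assign :: "reg \<Rightarrow> ex \<Rightarrow> com" where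
  "assign x e = Seq (compile 40 e) (copy x 40)"

definition store :: "ex \<Rightarrow> ex \<Rightarrow> com" where
  "store a e = Seq (compile 40 a) (Seq (compile 41 e) (Store 40 41))"

definition same_regs :: "(reg \<Rightarrow> nat) \<Rightarrow> (reg \<Rightarrow> nat) \<Rightarrow> bool" where
  "same_regs R R' \<longleftrightarrow> (\<forall>x<40. R' x = R x)"

lemma runs_assign:
  assumes "wf_ex e" "x < 40" "bounded X R"
    and "\<And>R'. same_regs (R(x := ev e R M)) R' \<Longrightarrow> Q (R', M)"
  shows "runs (assign x e) (R, M) (ex_time e X + 2) Q"
  unfolding assign_def
  by (rule runs_Seq, rule runs_compile[OF assms(1) _ assms(3)], simp, rule runs_copy, rule assms(4))
    (use assms(2) in \<open>simp_all add: same_regs_def\<close>)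

lemma runs_store:
  assumes "wf_ex a" "wf_ex e" "bounded X R"
    and "\<And>R'. same_regs R R' \<Longrightarrow> Q (R', M(ev a R M := ev e R M))"
  shows "runs (store a e) (R, M) (ex_time a X + (ex_time e X + 1)) Q"
  unfolding store_def
proof (rule runs_Seq, rule runs_compile[OF assms(1) _ assms(3)])
  fix R1 assume R1: "R1 40 = ev a R M" "\<And>x. x < 40 \<Longrightarrow> R1 x = R x"
  have e: "ev e R1 M = ev e R M" by (rule ev_cong[OF assms(2)]) (use R1 in simp)
  have bd: "bounded X R1" by (rule bounded_cong[OF assms(3)]) (use R1 in simp)
  show "runs (Seq (compile 41 e) (Store 40 41)) (R1, M) (ex_time e X + 1) Q"
  proof (rule runs_Seq, rule runs_compile[OF assms(2) _ bd])
    fix R2 assume R2: "R2 41 = ev e R1 M" "\<And>x. x < 41 \<Longrightarrow> R2 x = R1 x"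
    have "same_regs R R2" using R1 R2 by (simp add: same_regs_def)
    then show "runs (Store 40 41) (R2, M) 1 Q"
      using R1 R2 e assms(4)[of R2] by (intro runs_Store) simp
  qed simp
qed simp

definition for_loop :: "reg \<Rightarrow> reg \<Rightarrow> reg \<Rightarrow> com \<Rightarrow> com" where
  "for_loop x y b c = Seq (assign x (Lit 0)) (Seq (assign y (Var b))
     (While y (Seq c (Seq (assign x (Plus (Var x) (Lit 1))) (assign y (Minus (Var b) (Var x)))))))"

text \<open>The premise \<open>cong\<close> makes the invariant independent of the two loop
  registers and of scratch space, so updating the counters preserves it. Of the 14 extra steps per
  round, 6 and 7 go to the two counter updates and 1 to the test; 10 covers the two initial
  assignments and the last test.\<close>

lemma runs_for_loop:
  assumes regs: "12 \<le> x" "x < 40" "12 \<le> y" "y < 40" "x \<noteq> y" "b < 12"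
    and bd: "\<And>i R M. I i R M \<Longrightarrow> bounded X R \<and> R b = N"
    and cong: "\<And>i R R' M. I i R M \<Longrightarrow> (\<And>z. z < 40 \<Longrightarrow> z \<noteq> x \<Longrightarrow> z \<noteq> y \<Longrightarrow> R' z = R z) \<Longrightarrow> I i R' M"
    and step: "\<And>i R M. i < N \<Longrightarrow> I i R M \<Longrightarrow> R x = i \<Longrightarrow>
      runs c (R, M) T (\<lambda>(R', M'). I (Suc i) R' M' \<and> R' x = i)"
    and init: "I 0 R M" and "N \<le> X"
    and Q: "\<And>R' M'. I N R' M' \<Longrightarrow> Q (R', M')"
  shows "runs (for_loop x y b c) (R, M) (10 + X * (T + 14)) Q"
proof -
  define J where "J i s = (case s of (R, M) \<Rightarrow> I i R M \<and> R x = i \<and> R y = N - i)" for i s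
  let ?c = "Seq c (Seq (assign x (Plus (Var x) (Lit 1))) (assign y (Minus (Var b) (Var x))))"
  let ?Tx = "ex_time (Plus (Var x) (Lit 1)) X + 2"
  let ?Ty = "ex_time (Minus (Var b) (Var x)) X + 2"
  have b: "b \<noteq> x" "b \<noteq> y" "b < 40" using regs by auto
  have tail: "runs (Seq (assign x (Plus (Var x) (Lit 1))) (assign y (Minus (Var b) (Var x)))) (R, M)
       (?Tx + ?Ty) (J (Suc i))" if "I (Suc i) R M" "R x = i" for R M i
  proof (rule runs_Seq, rule runs_assign)
    fix R1 assume R1: "same_regs (R(x := ev (Plus (Var x) (Lit 1)) R M)) R1"
    have I1: "I (Suc i) R1 M" by (rule cong[OF that(1)]) (use R1 in \<open>simp add: same_regs_def\<close>)
    show "runs (assign y (Minus (Var b) (Var x))) (R1, M) ?Ty (J (Suc i))"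
    proof (rule runs_assign)
      fix R2 assume R2: "same_regs (R1(y := ev (Minus (Var b) (Var x)) R1 M)) R2"
      have "I (Suc i) R2 M" by (rule cong[OF I1]) (use R2 in \<open>simp add: same_regs_def\<close>)
      moreover have "R1 b = N" using bd[OF I1] by simp
      ultimately show "J (Suc i) (R2, M)"
        using R1 R2 that regs by (simp add: J_def same_regs_def)
    qed (use regs b bd[OF I1] in simp_all)
  qed (use regs b bd[OF that(1)] in simp_all)
  have loop: "runs (While y ?c) s (N * (T + (?Tx + ?Ty) + 1) + 1) (J N)" if "J 0 s" for s
  proof (rule runs_While)
    fix i s assume i: "i < N" and J: "J i s"
    obtain R M where s: "s = (R, M)" by fastforce
    have "runs ?c s (T + (?Tx + ?Ty)) (J (Suc i))" unfolding s
    proof (rule runs_Seq, rule runs_conseq[OF step[OF i]])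
      show "runs (Seq (assign x (Plus (Var x) (Lit 1))) (assign y (Minus (Var b) (Var x)))) s'
         (?Tx + ?Ty) (J (Suc i))" if "case s' of (R', M') \<Rightarrow> I (Suc i) R' M' \<and> R' x = i" for s'
        using that tail by (cases s') simp
    qed (use J s in \<open>auto simp: J_def\<close>)
    then show "fst s y \<noteq> 0 \<and> runs ?c s (T + (?Tx + ?Ty)) (J (Suc i))"
      using J i s by (auto simp: J_def)
  qed (use that in \<open>auto simp: J_def\<close>)
  have le: "N * (T + (?Tx + ?Ty) + 1) + 1 \<le> X * (T + 14) + 2"
    using mult_le_mono1[OF \<open>N \<le> X\<close>, of "T + 14"] mult_le_mono2[of "T + (?Tx + ?Ty) + 1" "T + 14" N]
    by (simp add: numeral_eq_Suc)
  have Q': "Q s'" if "J N s'" for s' using that Q by (cases s') (auto simp: J_def)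
  show ?thesis unfolding for_loop_def
  proof (rule runs_conseq)
    show "runs (Seq (assign x (Lit 0)) (Seq (assign y (Var b)) (While y ?c))) (R, M)
       ((1 + 2) + ((2 + 2) + (X * (T + 14) + 2))) Q"
    proof (rule runs_Seq, rule runs_assign[of "Lit 0" _ X, unfolded ex_time.simps])
      fix R1 assume R1: "same_regs (R(x := ev (Lit 0) R M)) R1"
      have I1: "I 0 R1 M" by (rule cong[OF init]) (use R1 in \<open>simp add: same_regs_def\<close>)
      show "runs (Seq (assign y (Var b)) (While y ?c)) (R1, M) (2 + 2 + (X * (T + 14) + 2)) Q"
      proof (rule runs_Seq, rule runs_assign[of "Var b" _ X, unfolded ex_time.simps])
        fix R2 assume R2: "same_regs (R1(y := ev (Var b) R1 M)) R2"
        have I2: "I 0 R2 M" by (rule cong[OF I1]) (use R2 in \<open>simp add: same_regs_def\<close>)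
        have "J 0 (R2, M)" using I2 R1 R2 regs bd[OF I1] by (simp add: J_def same_regs_def)
        then show "runs (While y ?c) (R2, M) (X * (T + 14) + 2) Q"
          by (rule runs_conseq[OF loop le Q'])
      qed (use regs b bd[OF I1] in simp_all)
    qed (use regs bd[OF init] in simp_all)
  qed simp_all
qed

section \<open>Polynomial time bounds\<close>

text \<open>The base \<open>X + 1\<close> is at least 1 even for \<open>X = 0\<close>, so exponents
  may be enlarged freely when two bounds are added.\<close>

definition poly_bounded :: "(nat \<Rightarrow> nat) \<Rightarrow> bool" where
  "poly_bounded f \<longleftrightarrow> (\<exists>K D. \<forall>X. f X \<le> K * (X + 1) ^ D)"

lemma poly_bounded_const: "poly_bounded (\<lambda>_. c)"
  unfolding poly_bounded_def by (rule exI[of _ c], rule exI[of _ 0]) simp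

lemma poly_bounded_id: "poly_bounded (\<lambda>X. X)"
  unfolding poly_bounded_def by (rule exI[of _ 1], rule exI[of _ 1]) simp

lemma poly_bounded_add:
  assumes "poly_bounded f" "poly_bounded g"
  shows "poly_bounded (\<lambda>X. f X + g X)"
proof -
  obtain K D K' D' where *: "\<And>X. f X \<le> K * (X + 1) ^ D" "\<And>X. g X \<le> K' * (X + 1) ^ D'"
    using assms unfolding poly_bounded_def by blast
  have "f X + g X \<le> (K + K') * (X + 1) ^ (D + D')" for X
  proof -
    have "K * (X + 1) ^ D \<le> K * (X + 1) ^ (D + D')" "K' * (X + 1) ^ D' \<le> K' * (X + 1) ^ (D + D')"
      by (intro mult_le_mono2 power_increasing; simp)+
    then have "f X + g X \<le> K * (X + 1) ^ (D + D') + K' * (X + 1) ^ (D + D')"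
      using *(1)[of X] *(2)[of X] by linarith
    then show ?thesis by (simp only: add_mult_distrib)
  qed
  then show ?thesis unfolding poly_bounded_def by blast
qed

lemma poly_bounded_mult:
  assumes "poly_bounded f" "poly_bounded g"
  shows "poly_bounded (\<lambda>X. f X * g X)"
proof -
  obtain K D K' D' where *: "\<And>X. f X \<le> K * (X + 1) ^ D" "\<And>X. g X \<le> K' * (X + 1) ^ D'"
    using assms unfolding poly_bounded_def by blast
  have "f X * g X \<le> (K * K') * (X + 1) ^ (D + D')" for X
    using mult_le_mono[OF *(1)[of X] *(2)[of X]] by (simp only: power_add mult_ac)
  then show ?thesis unfolding poly_bounded_def by blast
qed

lemmas poly_bounded_intros =
  poly_bounded_const poly_bounded_id poly_bounded_add poly_bounded_mult

lemma poly_bounded_ex_time: "poly_bounded (ex_time e)"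
  proof (induction e)
  case (Plus a b)
  then show ?case unfolding ex_time.simps by (intro poly_bounded_intros)
next
  case (Minus a b)
  then show ?case unfolding ex_time.simps by (intro poly_bounded_intros)
next
  case (Cell a)
  then show ?case unfolding ex_time.simps by (intro poly_bounded_intros)
next
  case (Cond c a b)
  then show ?case unfolding ex_time.simps by (intro poly_bounded_intros)
next
  case (Bind x a b)
  then show ?case unfolding ex_time.simps by (intro poly_bounded_intros)
next
  case (Total x b a)
  then show ?case unfolding ex_time.simps by (intro poly_bounded_intros)
qed (simp_all only: ex_time.simps poly_bounded_const)

section \<open>Deciding b-colorability by guessing digits\<close>

text \<open>A system of distinct representatives with minimal sum uses only small ranks.\<close>

lemma distinct_representatives_of_small_rank:
  fixes W :: "nat set" and A :: "nat \<Rightarrow> nat set"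
  assumes W: "finite W" "card W \<le> m" and A: "\<And>w. w \<in> W \<Longrightarrow> w \<in> A w" "\<And>w. w \<in> W \<Longrightarrow> finite (A w)"
  shows "\<exists>f. inj_on f W \<and> (\<forall>w\<in>W. f w \<in> A w \<and> card {z \<in> A w. z \<le> f w} \<le> m)"
proof -
  let ?P = "\<lambda>f. inj_on f W \<and> (\<forall>w\<in>W. f w \<in> A w)"
  have "?P id" using A by auto
  then obtain f where f: "?P f" and least: "\<And>g. ?P g \<Longrightarrow> sum f W \<le> sum g W"
    using exists_least_iff[of "\<lambda>N. \<exists>f. ?P f \<and> sum f W = N"] by (metis not_less)
  have "card {z \<in> A w. z \<le> f w} \<le> m" if w: "w \<in> W" for w
  proof (rule ccontr)
    assume "\<not> ?thesis"
    then have big: "card {z \<in> A w. z \<le> f w} > card W" using W by simp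
    have "card (f ` W) \<le> card W" using W(1) by (rule card_image_le)
    then have "\<not> {z \<in> A w. z \<le> f w} \<subseteq> f ` W"
      using big W(1) by (meson card_mono finite_imageI leD le_trans)
    then obtain z where z: "z \<in> A w" "z \<le> f w" "z \<notin> f ` W" by blast
    then have "z < f w" using w by (metis imageI le_neq_implies_less)
    have "?P (f(w := z))" using f z by (auto simp: inj_on_def)
    from least[OF this] have "sum f W \<le> sum (f(w := z)) W" .
    moreover have "sum (f(w := z)) W < sum f W"
      by (rule sum_strict_mono_ex1) (use W w \<open>z < f w\<close> in auto)
    ultimately show False by simp
  qed
  then show ?thesis using f by blast
qed

text \<open>
  A guess \<open>\<delta>\<close> is a sequence of digits. The first \<open>l\<close> digits color the vertex cover \<open>S\<close>. Then there is
  one row of \<open>2 * l + 1\<close> digits for every color \<open>j\<close>: the first \<open>l\<close> assign a group to every cover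
  vertex that is to get a neighbor of color \<open>j\<close> outside \<open>S\<close>, the others choose, for each group
  \<open>a < l + 1\<close>, the vertex that serves it, by its rank (counted from 1; 0 chooses nothing) among the
  candidates.
\<close>

locale slots =
  fixes n k l :: nat and E :: "nat \<Rightarrow> nat \<Rightarrow> bool" and S :: "nat \<Rightarrow> bool"
begin

definition cover_rank :: "nat \<Rightarrow> nat" where
  "cover_rank u = card {w. w < n \<and> w < u \<and> S w}"

definition row :: "nat \<Rightarrow> nat" where
  "row j = l + j * (2 * l + 1)"

definition cover_color :: "(nat \<Rightarrow> nat) \<Rightarrow> nat \<Rightarrow> nat" where
  "cover_color \<delta> u = \<delta> (cover_rank u)"

definition group :: "(nat \<Rightarrow> nat) \<Rightarrow> nat \<Rightarrow> nat \<Rightarrow> nat" where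
  "group \<delta> j u = \<delta> (row j + cover_rank u)"

definition choice_rank :: "(nat \<Rightarrow> nat) \<Rightarrow> nat \<Rightarrow> nat \<Rightarrow> nat" where
  "choice_rank \<delta> j a = \<delta> (row j + l + a)"

text \<open>When \<open>S\<close> is a cover, all neighbors of a vertex outside \<open>S\<close> are
  cover vertices. Absence of a conflict therefore depends on the cover colors only, however the
  other vertices outside \<open>S\<close> are colored.\<close>

definition allowed :: "(nat \<Rightarrow> nat) \<Rightarrow> nat \<Rightarrow> nat \<Rightarrow> bool" where
  "allowed \<delta> j v \<longleftrightarrow> \<not> S v \<and> (\<forall>u<n. E u v \<longrightarrow> cover_color \<delta> u \<noteq> j)"

definition candidate :: "(nat \<Rightarrow> nat) \<Rightarrow> nat \<Rightarrow> nat \<Rightarrow> nat \<Rightarrow> bool" where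
  "candidate \<delta> j a v \<longleftrightarrow> allowed \<delta> j v \<and> (\<forall>u<n. S u \<and> group \<delta> j u = a \<longrightarrow> E u v)"

definition chosen :: "(nat \<Rightarrow> nat) \<Rightarrow> nat \<Rightarrow> nat \<Rightarrow> nat \<Rightarrow> bool" where
  "chosen \<delta> j a v \<longleftrightarrow> candidate \<delta> j a v \<and>
     choice_rank \<delta> j a = card {w. w < n \<and> w \<le> v \<and> candidate \<delta> j a w}"

definition slot_color :: "(nat \<Rightarrow> nat) \<Rightarrow> nat \<Rightarrow> nat \<Rightarrow> bool" where
  "slot_color \<delta> v j \<longleftrightarrow> (\<exists>a<l+1. chosen \<delta> j a v)"

definition partial_color :: "(nat \<Rightarrow> nat) \<Rightarrow> nat \<Rightarrow> nat \<Rightarrow> bool" where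
  "partial_color \<delta> v j \<longleftrightarrow> S v \<and> cover_color \<delta> v = j \<or> slot_color \<delta> v j"

text \<open>
  The last condition refers to cover vertices and chosen vertices only; by the third one the
  remaining vertices can be colored arbitrarily.
\<close>

definition check :: "(nat \<Rightarrow> nat) \<Rightarrow> bool" where
  "check \<delta> \<longleftrightarrow>
     (\<forall>u<n. S u \<longrightarrow> cover_color \<delta> u < k) \<and>
     (\<forall>u<n. \<forall>v<n. S u \<and> S v \<and> E u v \<longrightarrow> cover_color \<delta> u \<noteq> cover_color \<delta> v) \<and>
     (\<forall>v<n. \<not> S v \<longrightarrow> (\<exists>j<k. allowed \<delta> j v)) \<and>
     (\<forall>v<n. \<forall>i<k. \<forall>j<k. slot_color \<delta> v i \<and> slot_color \<delta> v j \<longrightarrow> i = j) \<and>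
     (\<forall>j<k. \<exists>v<n. partial_color \<delta> v j \<and>
        (\<forall>i<k. i \<noteq> j \<longrightarrow> (\<exists>w<n. E v w \<and> partial_color \<delta> w i)))"

definition b_color_fun :: "(nat \<Rightarrow> nat) \<Rightarrow> bool" where
  "b_color_fun c \<longleftrightarrow> (\<forall>v<n. c v < k) \<and> (\<forall>u v. E u v \<longrightarrow> c u \<noteq> c v) \<and>
     (\<forall>j<k. \<exists>v<n. c v = j \<and> (\<forall>i<k. i \<noteq> j \<longrightarrow> (\<exists>w<n. E v w \<and> c w = i)))"

lemma slot_color_allowed: "slot_color \<delta> v j \<Longrightarrow> allowed \<delta> j v"
  unfolding slot_color_def chosen_def candidate_def by blast

end

section \<open>Soundness and completeness of the check for a graph with a vertex cover\<close>

locale covered_graph = slots +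
  assumes sym: "E u v \<Longrightarrow> E v u" and vert: "E u v \<Longrightarrow> u < n"
    and cover: "E u v \<Longrightarrow> S u \<or> S v" and l_def: "l = card {u. u < n \<and> S u}"
begin

text \<open>Cover vertices take their guessed color, chosen vertices the color of their slot, and
  all others any allowed color. Vertices outside \<open>S\<close> are pairwise nonadjacent, so
  allowed colors cannot clash, and slot colors are unique by the fourth condition. The result
  extends \<open>partial_color\<close>, hence keeps the b-vertices found by the last condition. Any
  digits passing the tests will do, whatever partition they were meant to encode.\<close>

lemma check_sound:
  assumes "check \<delta>"
  shows "\<exists>c. b_color_fun c"
proof -
  note ch = assms[unfolded check_def]
  define c where "c v = (if S v then cover_color \<delta> v
    else if \<exists>j<k. slot_color \<delta> v j then (SOME j. j < k \<and> slot_color \<delta> v j)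
    else (SOME j. j < k \<and> allowed \<delta> j v))" for v
  have c_slot: "c v < k \<and> slot_color \<delta> v (c v)" if "\<not> S v" "\<exists>j<k. slot_color \<delta> v j" for v
    using someI_ex[of "\<lambda>j. j < k \<and> slot_color \<delta> v j"] that by (auto simp: c_def)
  have c_rest: "c v < k \<and> allowed \<delta> (c v) v" if "\<not> S v" "\<not> (\<exists>j<k. slot_color \<delta> v j)" "v < n" for v
    using someI_ex[of "\<lambda>j. j < k \<and> allowed \<delta> j v"] that ch by (auto simp: c_def)
  have c_allowed: "c v < k \<and> allowed \<delta> (c v) v" if "\<not> S v" "v < n" for v
    using c_slot[of v] c_rest[of v] that slot_color_allowed by blast
  have c_cover: "c v = cover_color \<delta> v" if "S v" for v using that by (simp add: c_def)
  have unique: "\<forall>v<n. \<forall>i<k. \<forall>j<k. slot_color \<delta> v i \<and> slot_color \<delta> v j \<longrightarrow> i = j"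
    using ch by (elim conjE)
  have c_partial: "c v = j" if "partial_color \<delta> v j" "v < n" "j < k" for v j
  proof (cases "S v")
    case True
    then show ?thesis using that slot_color_allowed[of \<delta> v j]
      by (auto simp: partial_color_def c_cover allowed_def)
  next
    case False
    then have "slot_color \<delta> v j" using that by (simp add: partial_color_def)
    moreover from this have "slot_color \<delta> v (c v)" "c v < k" using c_slot[OF False] that(3) by auto
    ultimately show ?thesis using unique that(2,3) by metis
  qed
  have proper: "c u \<noteq> c v" if e: "E u v" and u: "S u" for u v
  proof (cases "S v")
    case True
    then show ?thesis using ch e u vert[OF e] vert[OF sym[OF e]] by (simp add: c_cover)
  next
    case False
    then show ?thesis using c_allowed[OF False vert[OF sym[OF e]]] e u vert[OF e]
      by (auto simp: c_cover allowed_def)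
  qed
  have "b_color_fun c" unfolding b_color_fun_def
  proof (intro conjI allI impI)
    fix v assume "v < n"
    then show "c v < k" using ch c_allowed[of v] c_cover[of v] by (cases "S v") auto
  next
    fix u v assume e: "E u v"
    show "c u \<noteq> c v" using proper[OF e] proper[OF sym[OF e]] cover[OF e] by force
  next
    fix j assume j: "j < k"
    then obtain v where v: "v < n" "partial_color \<delta> v j"
      "\<And>i. i < k \<Longrightarrow> i \<noteq> j \<Longrightarrow> \<exists>w<n. E v w \<and> partial_color \<delta> w i" using ch by blast
    then show "\<exists>v<n. c v = j \<and> (\<forall>i<k. i \<noteq> j \<longrightarrow> (\<exists>w<n. E v w \<and> c w = i))"
      using c_partial j by blast
  qed
  then show ?thesis by blast
qed

lemma b_color_fun_few_colors:
  assumes "b_color_fun c"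
  shows "k \<le> l + 1"
proof (rule ccontr)
  assume "\<not> ?thesis"
  then have k: "l + 2 \<le> k" by simp
  let ?T = "c ` {u. u < n \<and> S u}"
  have fin: "finite {u. u < n \<and> S u}" by simp
  have "card ?T \<le> l" unfolding l_def by (rule card_image_le[OF fin])
  then have "2 \<le> card ({..<k} - ?T)"
    using diff_card_le_card_Diff[of ?T "{..<k}"] k fin by simp
  then obtain D where "D \<subseteq> {..<k} - ?T" "card D = 2"
    by (meson obtain_subset_with_card_n)
  then obtain i j where ij: "i \<in> {..<k} - ?T" "j \<in> {..<k} - ?T" "i \<noteq> j"
    unfolding card_2_iff by blast
  have "\<exists>v<n. c v = i \<and> (\<forall>j<k. j \<noteq> i \<longrightarrow> (\<exists>w<n. E v w \<and> c w = j))"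
    using assms ij(1) unfolding b_color_fun_def by simp
  then obtain v where v: "v < n" "c v = i" "\<And>j. j < k \<Longrightarrow> j \<noteq> i \<Longrightarrow> \<exists>w<n. E v w \<and> c w = j"
    by blast
  then obtain w where vw: "w < n" "E v w" "c w = j" using v(3)[of j] ij by auto
  then show False using cover[OF vw(2)] v ij by auto
qed

lemma cover_rank_less: "u < n \<Longrightarrow> S u \<Longrightarrow> cover_rank u < l"
  unfolding cover_rank_def l_def by (rule psubset_card_mono) auto

lemma cover_rank_inj:
  assumes "u < n" "S u" "v < n" "S v" "cover_rank u = cover_rank v"
  shows "u = v"
proof -
  have less: "cover_rank x < cover_rank y" if "x < y" "x < n" "S x" for x y
    unfolding cover_rank_def by (rule psubset_card_mono) (use that in auto)
  show ?thesis using less[of u v] less[of v u] assms by (metis less_irrefl nat_neq_iff)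
qed

text \<open>From the b-coloring \<open>c\<close>, the vertices of color \<open>j\<close> outside
  \<open>S\<close> that matter form \<open>W j\<close>; \<open>h j\<close> numbers them as groups,
  and \<open>f\<close> moves each to a representative of small rank. The base
  \<open>row k + 2\<close> exceeds all values needed: colors below \<open>k\<close>, group numbers
  up to \<open>l + 1\<close>, ranks up to \<open>k * (l + 1)\<close>. Agreement is asked for below
  \<open>row k\<close> only, because the digits of a decoded number are under control only
  there.\<close>

lemma check_complete:
  assumes c: "b_color_fun c"
  shows "\<exists>\<delta>. (\<forall>e. \<delta> e < row k + 2) \<and>
    (\<forall>\<delta>'. (\<forall>e<row k. \<delta>' e = \<delta> e) \<longrightarrow> check \<delta>')"
proof -
  have ck: "\<And>v. v < n \<Longrightarrow> c v < k" and proper: "\<And>u v. E u v \<Longrightarrow> c u \<noteq> c v"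
    and "\<forall>j<k. \<exists>v. v < n \<and> c v = j \<and> (\<forall>i<k. i \<noteq> j \<longrightarrow> (\<exists>w<n. E v w \<and> c w = i))"
    using c unfolding b_color_fun_def by auto
  then obtain b where b: "\<And>j. j < k \<Longrightarrow> b j < n" "\<And>j. j < k \<Longrightarrow> c (b j) = j"
    "\<And>j i. j < k \<Longrightarrow> i < k \<Longrightarrow> i \<noteq> j \<Longrightarrow> \<exists>w<n. E (b j) w \<and> c w = i" by metis
  define has where "has j u \<longleftrightarrow> (\<exists>z<n. \<not> S z \<and> E u z \<and> c z = j)" for j u
  text \<open>A cover vertex next to a b-vertex outside \<open>S\<close> is served by that b-vertex, so any candidate
    replacing the b-vertex in its slot sees the same colors and can take over its role.\<close>
  define w where "w j u = (if \<not> S (b j) \<and> E u (b j) then b j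
    else SOME z. z < n \<and> \<not> S z \<and> E u z \<and> c z = j)" for j u
  have w: "w j u < n \<and> \<not> S (w j u) \<and> E u (w j u) \<and> c (w j u) = j" if "has j u" "j < k" for j u
    using someI_ex[of "\<lambda>z. z < n \<and> \<not> S z \<and> E u z \<and> c z = j"] that b
    unfolding has_def w_def by auto
  \<comment> \<open>One serving vertex for each cover vertex that needs one, plus the b-vertex
    itself if it lies outside \<open>S\<close>: at most \<open>l + 1\<close> vertices.\<close>
  define W where "W j = w j ` {u. u < n \<and> S u \<and> has j u} \<union> (if S (b j) then {} else {b j})" for j
  have W: "z < n \<and> \<not> S z \<and> c z = j" if "z \<in> W j" "j < k" for z j
    using that w b unfolding W_def by (auto split: if_splits)
  have finW: "finite (W j)" for j unfolding W_def by simp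
  have cardW: "card (W j) \<le> l + 1" for j
  proof -
    have "card (w j ` {u. u < n \<and> S u \<and> has j u}) \<le> card {u. u < n \<and> S u \<and> has j u}"
      by (rule card_image_le) simp
    also have "\<dots> \<le> l" unfolding l_def by (rule card_mono) auto
    finally have "card (w j ` {u. u < n \<and> S u \<and> has j u}) \<le> l" .
    moreover have "card (if S (b j) then {} else {b j}) \<le> 1" by simp
    ultimately show ?thesis unfolding W_def
      by (meson add_mono card_Un_le le_trans)
  qed
  have "\<exists>h. inj_on h (W j) \<and> h ` W j \<subseteq> {..<l+1}" for j
    using card_le_inj[of "W j" "{..<l+1}"] finW cardW by auto
  then obtain h where h: "\<And>j. inj_on (h j) (W j)" "\<And>j. h j ` W j \<subseteq> {..<l+1}" by metis
  \<comment> \<open>The default \<open>l + 1\<close> is not a slot number, so a cover vertex that is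
    not to be served constrains no candidate.\<close>
  define x where "x j u = (if has j u then h j (w j u) else l + 1)" for j u
  \<comment> \<open>The candidates of the slot of \<open>v\<close>, written with \<open>c\<close>
    and \<open>x\<close> before any digits exist; \<open>cand\<close> identifies the two
    later.\<close>
  define A where "A v = {z. z < n \<and> \<not> S z \<and> (\<forall>u<n. E u z \<longrightarrow> c u \<noteq> c v) \<and>
     (\<forall>u<n. S u \<and> x (c v) u = h (c v) v \<longrightarrow> E u z)}" for v
  let ?W = "\<Union>j<k. W j"
  have wW: "w j u \<in> W j" if "u < n" "S u" "has j u" for j u using that unfolding W_def by auto
  have group_adj: "E u v" if "v \<in> W j" "j < k" "u < n" "S u" "x j u = h j v" for j u v
  proof -
    have "h j v < l + 1" using h(2) that(1) by auto
    then have "has j u" "h j (w j u) = h j v" using that unfolding x_def by (auto split: if_splits)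
    then show ?thesis using h(1)[of j] wW that w by (metis inj_onD)
  qed
  have selfA: "v \<in> A v" if "v \<in> ?W" for v
    using that W group_adj proper unfolding A_def by fastforce
  have "card ?W \<le> (\<Sum>j<k. card (W j))" by (rule card_UN_le) simp
  also have "\<dots> \<le> (\<Sum>j<k. l + 1)" by (rule sum_mono) (rule cardW)
  also have "\<dots> = k * (l + 1)" by simp
  finally have card_slots: "card ?W \<le> k * (l + 1)" .
  have finA: "finite (A v)" for v unfolding A_def by simp
  have finU: "finite ?W" using finW by simp
  \<comment> \<open>One application to the union over all colors: representatives must differ across
    colors too, since a shared vertex would get two colors.\<close>
  from distinct_representatives_of_small_rank[of ?W _ A, OF finU card_slots selfA finA] obtain f where f: "inj_on f ?W" "\<And>v. v \<in> ?W \<Longrightarrow> f v \<in> A v"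
    "\<And>v. v \<in> ?W \<Longrightarrow> card {z \<in> A v. z \<le> f v} \<le> k * (l + 1)"
    by metis
  define y where "y j a = (if \<exists>v\<in>W j. h j v = a
     then (let v = (SOME v. v \<in> W j \<and> h j v = a) in card {z \<in> A v. z \<le> f v}) else 0)" for j a
  have y: "y j (h j v) = card {z \<in> A v. z \<le> f v}" if "v \<in> W j" for j v
  proof -
    have "(SOME v'. v' \<in> W j \<and> h j v' = h j v) = v"
      using that h(1)[of j] by (intro some_equality) (auto dest: inj_onD)
    then show ?thesis using that unfolding y_def by (auto simp: Let_def)
  qed
  define sv where "sv e = (SOME u. u < n \<and> S u \<and> cover_rank u = e)" for e
  have sv: "sv (cover_rank u) = u" if "u < n" "S u" for u
    unfolding sv_def by (rule some_equality) (use that cover_rank_inj in auto)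
  \<comment> \<open>Inverts the layout given by \<open>row\<close>: after the first \<open>l\<close>
    digits, the quotient is the color and the remainder the place within its row.\<close>
  define \<delta>0 where "\<delta>0 e = (if e < l then c (sv e) else
     (let q = (e - l) div (2 * l + 1); r = (e - l) mod (2 * l + 1)
      in if r < l then x q (sv r) else y q (r - l)))" for e
  \<comment> \<open>The truncation yields the bound at every position; by \<open>d_color\<close>,
    \<open>d_group\<close> and \<open>d_rank\<close> it alters none of the digits that
    matter.\<close>
  define \<delta>1 where "\<delta>1 e = (if \<delta>0 e < row k + 2 then \<delta>0 e else 0)" for e
  have row_ge: "l + k \<le> row k" "k * (l + 1) \<le> row k" by (auto simp: row_def algebra_simps)
  have row_less: "row j + r < row k" if "j < k" "r < 2 * l + 1" for j r
  proof -
    have "Suc j * (2 * l + 1) \<le> k * (2 * l + 1)" using that(1) by (intro mult_le_mono1) simp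
    then show ?thesis using that(2) by (simp add: row_def)
  qed
  have "check \<delta>" if \<delta>: "\<And>e. e < row k \<Longrightarrow> \<delta> e = \<delta>1 e" for \<delta>
  proof -
    have d_color: "cover_color \<delta> u = c u" if "u < n" "S u" for u
      using cover_rank_less[OF that] sv[OF that] ck[OF that(1)] row_ge
      by (simp add: cover_color_def \<delta> \<delta>1_def \<delta>0_def)
    have digit: "\<delta>0 (row j + r) = (if r < l then x j (sv r) else y j (r - l))" if "r < 2 * l + 1" for j r
    proof -
      have "row j + r - l = r + j * (2 * l + 1)" by (simp add: row_def)
      then have "(row j + r - l) div (2 * l + 1) = j" "(row j + r - l) mod (2 * l + 1) = r"
        using that div_mult_self1[of "2 * l + 1" r j] mod_mult_self1[of r j "2 * l + 1"] by simp_all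
      then show ?thesis unfolding \<delta>0_def by (auto simp: row_def Let_def)
    qed
    have x_le: "x j u \<le> l + 1" if "u < n" "S u" for j u
      using h(2)[of j] wW[OF that, of j] unfolding x_def by force
    have d_group: "group \<delta> j u = x j u" if "u < n" "S u" "j < k" for j u
      using digit[of "cover_rank u" j] cover_rank_less[OF that(1,2)] sv[OF that(1,2)] x_le[OF that(1,2), of j]
        row_ge row_less[OF that(3), of "cover_rank u"]
      by (simp add: group_def \<delta> \<delta>1_def)
    have y_le: "y j a \<le> k * (l + 1)" if "j < k" for j a
    proof (cases "\<exists>v\<in>W j. h j v = a")
      case True
      then obtain v where v: "v \<in> W j" "h j v = a" by blast
      then have "v \<in> ?W" using that by blast
      then show ?thesis using y[OF v(1)] f(3) v(2) by metis
    qed (simp add: y_def)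
    have d_rank: "choice_rank \<delta> j a = y j a" if "j < k" "a < l + 1" for j a
      using digit[of "l + a" j] y_le[OF that(1), of a] row_ge that row_less[OF that(1), of "l + a"]
      by (simp add: choice_rank_def \<delta> \<delta>1_def add.assoc)
    have allowed: "allowed \<delta> j v \<longleftrightarrow> \<not> S v \<and> (\<forall>u<n. E u v \<longrightarrow> c u \<noteq> j)" for j v
    proof -
      have "cover_color \<delta> u = c u" if "E u v" "\<not> S v" for u
        using d_color[OF vert[OF that(1)]] cover[OF that(1)] that(2) by blast
      then show ?thesis unfolding allowed_def by auto
    qed
    have cand: "z < n \<and> candidate \<delta> j (h j v) z \<longleftrightarrow> z \<in> A v" if "v \<in> W j" "j < k" for v j z
      using W[OF that] d_group[OF _ _ that(2)] unfolding candidate_def allowed A_def by auto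
    have chosen: "chosen \<delta> j a z \<longleftrightarrow> (\<exists>v\<in>W j. h j v = a \<and> z = f v)"
      if z: "z < n" and j: "j < k" and a: "a < l + 1" for z j a
    proof
      assume ch: "chosen \<delta> j a z"
      \<comment> \<open>Since \<open>z\<close> counts itself, its rank is positive, so slot
        \<open>a\<close> is a used one.\<close>
      have "0 < card {w. w < n \<and> w \<le> z \<and> candidate \<delta> j a w}"
        using ch z by (auto simp: card_gt_0_iff chosen_def)
      moreover have "y j a = card {w. w < n \<and> w \<le> z \<and> candidate \<delta> j a w}"
        using ch d_rank[OF j a] unfolding chosen_def by metis
      ultimately have "y j a \<noteq> 0" by linarith
      then obtain v where v: "v \<in> W j" "h j v = a" unfolding y_def by (auto split: if_splits)
      have sets: "{w. w < n \<and> w \<le> t \<and> candidate \<delta> j a w} = {w \<in> A v. w \<le> t}" for t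
        using cand[OF v(1) j] v(2) by blast
      have zA: "z \<in> A v" using cand[OF v(1) j] v(2) ch z by (auto simp: chosen_def)
      have fA: "f v \<in> A v" using f(2) v j by auto
      have eq: "card {w \<in> A v. w \<le> f v} = card {w \<in> A v. w \<le> z}"
        using ch d_rank[OF j a] y[OF v(1)] v(2) by (simp add: chosen_def sets)
      \<comment> \<open>Rank is strictly increasing along \<open>A v\<close>, so the two members
        \<open>z\<close> and \<open>f v\<close> with equal rank coincide.\<close>
      have less: "card {w \<in> A v. w \<le> s} < card {w \<in> A v. w \<le> t}" if "s < t" "t \<in> A v" for s t
      proof (rule psubset_card_mono)
        have "t \<in> {w \<in> A v. w \<le> t}" "t \<notin> {w \<in> A v. w \<le> s}" using that by simp_all
        then have "{w \<in> A v. w \<le> s} \<noteq> {w \<in> A v. w \<le> t}" by metis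
        moreover have "{w \<in> A v. w \<le> s} \<subseteq> {w \<in> A v. w \<le> t}" using that by auto
        ultimately show "{w \<in> A v. w \<le> s} \<subset> {w \<in> A v. w \<le> t}" by blast
      qed (use finA[of v] in simp)
      have "z = f v" using less[of z "f v"] less[of "f v" z] zA fA eq
        by (metis less_irrefl nat_neq_iff)
      then show "\<exists>v\<in>W j. h j v = a \<and> z = f v" using v by blast
    next
      assume "\<exists>v\<in>W j. h j v = a \<and> z = f v"
      then obtain v where v: "v \<in> W j" "h j v = a" "z = f v" by blast
      have "z \<in> A v" using f(2) v j by auto
      then have "candidate \<delta> j a z" using cand[OF v(1) j] v(2) by blast
      moreover have sets: "{w. w < n \<and> w \<le> z \<and> candidate \<delta> j a w} = {w \<in> A v. w \<le> z}"
        using cand[OF v(1) j] v(2) by blast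
      ultimately show "chosen \<delta> j a z"
        using v y[OF v(1)] d_rank[OF j a] by (simp add: chosen_def)
    qed
    have slot: "slot_color \<delta> z j \<longleftrightarrow> (\<exists>v\<in>W j. z = f v)" if "z < n" "j < k" for z j
      unfolding slot_color_def using chosen[OF that] h(2)[of j] by blast
    have fW: "f v < n \<and> slot_color \<delta> (f v) j" if "v \<in> W j" "j < k" for v j
    proof -
      have "f v < n" using f(2)[of v] that by (auto simp: A_def)
      then show ?thesis using slot that by auto
    qed
    have f_adj: "E u (f v)" if "v \<in> W j" "j < k" "u < n" "S u" "x j u = h j v" for u v j
      using f(2)[of v] that W[of v j] by (auto simp: A_def)
    have "check \<delta>" unfolding check_def
    proof (intro conjI allI impI)
      fix u assume "u < n" "S u"
      then show "cover_color \<delta> u < k" using d_color ck by simp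
    next
      fix u v assume "u < n" "v < n" "S u \<and> S v \<and> E u v"
      then show "cover_color \<delta> u \<noteq> cover_color \<delta> v" using d_color proper by simp
    next
      fix v assume "v < n" "\<not> S v"
      then show "\<exists>j<k. allowed \<delta> j v" using ck proper allowed by blast
    next
      fix v i j assume "v < n" "i < k" "j < k" "slot_color \<delta> v i \<and> slot_color \<delta> v j"
      then obtain a a' where "a \<in> W i" "a' \<in> W j" "f a = f a'" using slot by metis
      moreover from this have "a = a'" using f(1) \<open>i < k\<close> \<open>j < k\<close> by (auto dest: inj_onD)
      ultimately show "i = j" using W \<open>i < k\<close> \<open>j < k\<close> by blast
    next
      fix j assume j: "j < k"
      show "\<exists>v<n. partial_color \<delta> v j \<and>
          (\<forall>i<k. i \<noteq> j \<longrightarrow> (\<exists>w<n. E v w \<and> partial_color \<delta> w i))"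
      proof (cases "S (b j)")
        case True
        have "\<exists>w<n. E (b j) w \<and> partial_color \<delta> w i" if i: "i < k" "i \<noteq> j" for i
        proof -
          obtain w0 where w0: "w0 < n" "E (b j) w0" "c w0 = i" using b(3) j i by blast
          show ?thesis
          proof (cases "S w0")
            case True
            then show ?thesis using w0 d_color by (auto simp: partial_color_def)
          next
            case False
            then have has: "has i (b j)" using w0 by (auto simp: has_def)
            let ?z = "w i (b j)"
            have z: "?z \<in> W i" using wW b(1)[OF j] True has by blast
            have "E (b j) (f ?z)" by (rule f_adj[OF z i(1) b(1)[OF j] True]) (simp add: x_def has)
            then show ?thesis using fW[OF z i(1)] by (auto simp: partial_color_def)
          qed
        qed
        moreover have "partial_color \<delta> (b j) j" using True b j d_color by (simp add: partial_color_def)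
        ultimately show ?thesis using b(1)[OF j] by blast
      next
        case False
        then have bW: "b j \<in> W j" by (simp add: W_def)
        have "\<exists>w<n. E (f (b j)) w \<and> partial_color \<delta> w i" if i: "i < k" "i \<noteq> j" for i
        proof -
          obtain w0 where w0: "w0 < n" "E (b j) w0" "c w0 = i" using b(3) j i by blast
          have S0: "S w0" using cover[OF w0(2)] False by simp
          \<comment> \<open>The preference for \<open>b j\<close> in the definition of
            \<open>w\<close> puts every neighbor of \<open>b j\<close> into its group, so
            \<open>f (b j)\<close> is adjacent to all of them.\<close>
          have "has j w0" using b j False sym[OF w0(2)] by (auto simp: has_def)
          then have "x j w0 = h j (b j)" using False sym[OF w0(2)] by (simp add: x_def w_def)
          then have "E w0 (f (b j))" using f_adj[OF bW j w0(1) S0] by simp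
          then show ?thesis using sym w0 S0 d_color by (auto simp: partial_color_def)
        qed
        moreover have "f (b j) < n" "partial_color \<delta> (f (b j)) j"
          using fW[OF bW j] by (auto simp: partial_color_def)
        ultimately show ?thesis by blast
      qed
    qed
    then show ?thesis .
  qed
  moreover have "\<forall>e. \<delta>1 e < row k + 2" by (simp add: \<delta>1_def)
  ultimately show ?thesis by blast
qed

end

section \<open>The check as an expression\<close>

definition holds :: "ex \<Rightarrow> (reg \<Rightarrow> nat) \<Rightarrow> (nat \<Rightarrow> nat) \<Rightarrow> bool" where
  "holds e R M \<longleftrightarrow> ev e R M \<noteq> 0"

definition notE where "notE a = Cond a (Lit 0) (Lit 1)"
definition andE where "andE a b = Cond a b (Lit 0)"
definition orE where "orE a b = Cond a (Lit 1) b"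
definition impE where "impE a b = Cond a b (Lit 1)"
text \<open>Subtraction is truncated: a difference is nonzero exactly for a strict inequality, and
  in \<open>eqE\<close> the two opposite differences add up to the distance.\<close>

definition lessE where "lessE a b = Minus b a"
definition eqE where "eqE a b = Cond (Plus (Minus a b) (Minus b a)) (Lit 0) (Lit 1)"
definition exE where "exE x b a = Total x b a"
definition allE where "allE x b a = notE (exE x b (notE a))"
definition countE where "countE x b a = Total x b (Cond a (Lit 1) (Lit 0))"

lemma holds_simps [simp]:
  "holds (notE a) R M \<longleftrightarrow> \<not> holds a R M"
  "holds (andE a b) R M \<longleftrightarrow> holds a R M \<and> holds b R M"
  "holds (orE a b) R M \<longleftrightarrow> holds a R M \<or> holds b R M"
  "holds (impE a b) R M \<longleftrightarrow> (holds a R M \<longrightarrow> holds b R M)"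
  "holds (lessE a b) R M \<longleftrightarrow> ev a R M < ev b R M"
  "holds (eqE a b) R M \<longleftrightarrow> ev a R M = ev b R M"
  by (auto simp: holds_def notE_def andE_def orE_def impE_def lessE_def eqE_def)

lemma holds_exE [simp]: "holds (exE x b a) R M \<longleftrightarrow> (\<exists>i<R b. holds a (R(x := i)) M)"
  by (auto simp: holds_def exE_def)

lemma holds_allE [simp]: "holds (allE x b a) R M \<longleftrightarrow> (\<forall>i<R b. holds a (R(x := i)) M)"
  by (simp add: allE_def)

lemma ev_countE [simp]: "ev (countE x b a) R M = card {i. i < R b \<and> holds a (R(x := i)) M}"
  by (simp add: countE_def holds_def sum.If_cases Int_def)

text \<open>Multiplication as iterated addition; the register \<open>r\<close> only has to bound the first factor.\<close>

definition timesE :: "reg \<Rightarrow> ex \<Rightarrow> reg \<Rightarrow> ex" where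
  "timesE r a c = Bind 36 a (Total 37 r (Cond (lessE (Var 37) (Var 36)) (Var c) (Lit 0)))"

lemma ev_timesE:
  assumes "ev a R M \<le> R r" "r < 36" "c < 36 \<or> c > 37"
  shows "ev (timesE r a c) R M = ev a R M * R c"
proof -
  have "(\<Sum>z<N. if z < m then x else 0) = min m N * x" for N m x :: nat
    by (induction N) (auto simp: min_def not_less le_Suc_eq)
  moreover have "ev (Cond (lessE (Var 37) (Var 36)) (Var c) (Lit 0)) (R(36 := m, 37 := z)) M =
      (if z < m then R c else 0)" for m z
    using assms by (auto simp: lessE_def)
  moreover have "(R(36 := m)) r = R r" for m using assms by simp
  ultimately show ?thesis using assms(1) by (simp only: timesE_def ev.simps min_absorb1)
qed

text \<open>The quotient is the number of \<open>i\<close> with \<open>(i + 1) * b \<le> a\<close>.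
  The test of \<open>b\<close> makes division by zero give 0, as in HOL. Register 7 holds the number
  of guesses and so exceeds every quotient of a guess.\<close>

definition divE :: "reg \<Rightarrow> reg \<Rightarrow> ex" where
  "divE a b = countE 34 7
     (andE (Var b) (notE (lessE (Var a) (Plus (timesE 7 (Var 34) b) (Var b)))))"

lemma ev_divE:
  assumes "R a < R 7" "a \<notin> {34,36,37}" "b \<notin> {34,36,37}"
  shows "ev (divE a b) R M = R a div R b"
proof -
  have t: "ev (timesE 7 (Var 34) b) (R(34 := i)) M = i * R b" if "i < R 7" for i
  proof -
    have "b < 36 \<or> b > 37" using assms(3) by force
    then show ?thesis using ev_timesE[of "Var 34" "R(34 := i)" M 7 b] that assms by simp
  qed
  have "{i. i < R 7 \<and> R b \<noteq> 0 \<and> i * R b + R b \<le> R a} = {..<R a div R b}"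
  proof (cases "R b = 0")
    case False
    define q where "q = R a div R b"
    have eq: "i * R b + R b \<le> R a \<longleftrightarrow> i < q" for i
      unfolding Suc_le_eq[symmetric] q_def using False
      by (subst less_eq_div_iff_mult_less_eq) (simp_all add: add.commute)
    have "q < R 7" unfolding q_def by (rule le_less_trans[OF div_le_dividend assms(1)])
    then have "{i. i < R 7 \<and> i < q} = {..<q}" by auto
    then show ?thesis unfolding q_def[symmetric] eq by (simp only: False not_False_eq_True simp_thms)
  qed auto
  moreover have eqv: "holds (andE (Var b) (notE (lessE (Var a) (Plus (timesE 7 (Var 34) b) (Var b)))))
      (R(34 := i)) M \<longleftrightarrow> R b \<noteq> 0 \<and> i * R b + R b \<le> R a" if "i < R 7" for i
    using t[OF that] assms(2,3) by (simp add: holds_def[of "Var b"] not_less)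
  have "ev (divE a b) R M = card {i. i < R 7 \<and> R b \<noteq> 0 \<and> i * R b + R b \<le> R a}"
    unfolding divE_def ev_countE
    by (rule arg_cong[where f = card], rule Collect_cong, rule conj_cong[OF refl], rule eqv)
  ultimately show ?thesis by simp
qed

text \<open>Digit \<open>e\<close> of the guess in base \<open>R 6\<close>, provided that the table
  at \<open>R 10\<close> holds the powers of the base. Powers are tabulated beforehand because they
  are not among the derived expressions.\<close>

definition digit :: "(reg \<Rightarrow> nat) \<Rightarrow> (nat \<Rightarrow> nat) \<Rightarrow> nat \<Rightarrow> nat" where
  "digit R M e = (R 12 div M (R 10 + e)) mod R 6"

definition digitE :: "ex \<Rightarrow> ex" where
  "digitE e = Bind 38 (Cell (Plus (Var 10) e))
     (Bind 39 (divE 12 38) (Minus (Var 39) (timesE 7 (divE 39 6) 6)))"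

lemma ev_digitE:
  assumes "R 12 < R 7"
  shows "ev (digitE e) R M = digit R M (ev e R M)"
proof -
  let ?R = "R(38 := M (R 10 + ev e R M))"
  let ?q = "R 12 div M (R 10 + ev e R M)"
  have 1: "ev (divE 12 38) ?R M = ?q"
    using ev_divE[of ?R 12 38 M] assms by simp
  have q: "?q < R 7" by (rule le_less_trans[OF div_le_dividend assms])
  have 2: "ev (divE 39 6) (?R(39 := ?q)) M = ?q div R 6"
    using ev_divE[of "?R(39 := ?q)" 39 6 M] q by simp
  have "?q div R 6 \<le> R 7" by (rule le_trans[OF div_le_dividend less_imp_le[OF q]])
  then have "ev (timesE 7 (divE 39 6) 6) (?R(39 := ?q)) M = ?q div R 6 * R 6"
    using 2 ev_timesE[of "divE 39 6" "?R(39 := ?q)" M 7 6] by simp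
  then show ?thesis using 1 by (simp add: digitE_def digit_def minus_div_mult_eq_mod)
qed

text \<open>To rule out capture, binders in nested scopes use different registers: 13 to 17 for
  \<open>checkE\<close>, 29 to 32 for the macros below, 34 and 36 to 39 for arithmetic. Hence the
  side conditions such as \<open>j < 31\<close> in the lemmas about them.\<close>

definition coverE :: "ex \<Rightarrow> ex" where
  "coverE e = Cell (Plus (Var 8) e)"
definition adjE :: "reg \<Rightarrow> reg \<Rightarrow> ex" where
  "adjE u v = Cell (Plus (timesE 0 (Var u) 0) (Var v))"
definition rankE :: "reg \<Rightarrow> ex" where
  "rankE u = countE 32 0 (andE (lessE (Var 32) (Var u)) (coverE (Var 32)))"
definition rowE :: "reg \<Rightarrow> ex" where
  "rowE j = Plus (Var 2) (timesE 4 (Var j) 9)"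
definition cover_colorE :: "reg \<Rightarrow> ex" where
  "cover_colorE u = digitE (rankE u)"
definition groupE :: "reg \<Rightarrow> reg \<Rightarrow> ex" where
  "groupE j u = digitE (Plus (rowE j) (rankE u))"
definition choiceE :: "reg \<Rightarrow> reg \<Rightarrow> ex" where
  "choiceE j a = digitE (Plus (Plus (rowE j) (Var 2)) (Var a))"
definition allowedE :: "reg \<Rightarrow> reg \<Rightarrow> ex" where
  "allowedE j v = andE (notE (coverE (Var v)))
     (allE 31 0 (impE (adjE 31 v) (notE (eqE (cover_colorE 31) (Var j)))))"
definition candidateE :: "reg \<Rightarrow> reg \<Rightarrow> reg \<Rightarrow> ex" where
  "candidateE j a v = andE (allowedE j v)
     (allE 31 0 (impE (andE (coverE (Var 31)) (eqE (groupE j 31) (Var a))) (adjE 31 v)))"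
definition chosenE :: "reg \<Rightarrow> reg \<Rightarrow> reg \<Rightarrow> ex" where
  "chosenE j a v = andE (candidateE j a v)
     (eqE (choiceE j a) (countE 30 0 (andE (notE (lessE (Var v) (Var 30))) (candidateE j a 30))))"
definition slotE :: "reg \<Rightarrow> reg \<Rightarrow> ex" where
  "slotE v j = exE 29 3 (chosenE j 29 v)"
definition partialE :: "reg \<Rightarrow> reg \<Rightarrow> ex" where
  "partialE v j = orE (andE (coverE (Var v)) (eqE (cover_colorE v) (Var j))) (slotE v j)"
definition checkE :: ex where
  "checkE =
    andE (allE 13 0 (impE (coverE (Var 13)) (lessE (cover_colorE 13) (Var 4))))
   (andE (allE 13 0 (allE 14 0 (impE (andE (coverE (Var 13)) (andE (coverE (Var 14)) (adjE 13 14)))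
       (notE (eqE (cover_colorE 13) (cover_colorE 14))))))
   (andE (allE 14 0 (impE (notE (coverE (Var 14))) (exE 16 4 (allowedE 16 14))))
   (andE (allE 14 0 (allE 15 4 (allE 16 4 (impE (andE (slotE 14 15) (slotE 14 16)) (eqE (Var 15) (Var 16))))))
     (allE 16 4 (exE 14 0 (andE (partialE 14 16)
       (allE 15 4 (impE (notE (eqE (Var 15) (Var 16))) (exE 17 0 (andE (adjE 14 17) (partialE 17 15)))))))))))"

lemmas macro_defs = notE_def andE_def orE_def impE_def lessE_def eqE_def exE_def allE_def countE_def
  timesE_def divE_def digitE_def coverE_def adjE_def rankE_def rowE_def cover_colorE_def groupE_def
  choiceE_def allowedE_def candidateE_def chosenE_def slotE_def partialE_def

lemma wf_checkE: "wf_ex checkE"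
  unfolding checkE_def macro_defs by (simp add: bound_reg_def)

section \<open>The expressions compute the check on the decoded digits\<close>

context slots begin

text \<open>The values \<open>l + 1\<close> and \<open>2 * l + 1\<close> get registers of their own
  because the bound of a sum and the second factor of \<open>timesE\<close> have to be
  registers.\<close>

definition env :: "(reg \<Rightarrow> nat) \<Rightarrow> (nat \<Rightarrow> nat) \<Rightarrow> bool" where
  "env R M \<longleftrightarrow> R 0 = n \<and> R 2 = l \<and> R 3 = l + 1 \<and> R 4 = k \<and> R 9 = 2 * l + 1 \<and> R 12 < R 7 \<and>
     (\<forall>u<n. \<forall>v<n. M (u * n + v) \<noteq> 0 \<longleftrightarrow> E u v) \<and> (\<forall>u<n. M (R 8 + u) \<noteq> 0 \<longleftrightarrow> S u)"

lemma env_upd [simp]: "x > 12 \<Longrightarrow> env (R(x := i)) M = env R M"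
  by (simp add: env_def)

lemma digit_upd [simp]: "x > 12 \<Longrightarrow> digit (R(x := i)) M = digit R M"
  by (simp add: digit_def fun_eq_iff)

lemma holds_coverE: "env R M \<Longrightarrow> ev e R M < n \<Longrightarrow> holds (coverE e) R M \<longleftrightarrow> S (ev e R M)"
  by (simp add: env_def coverE_def holds_def)

lemma holds_adjE:
  "env R M \<Longrightarrow> R u < n \<Longrightarrow> R v < n \<Longrightarrow> holds (adjE u v) R M \<longleftrightarrow> E (R u) (R v)"
  by (simp add: env_def adjE_def holds_def ev_timesE)

lemma ev_rankE:
  assumes "env R M" "u \<noteq> 32"
  shows "ev (rankE u) R M = cover_rank (R u)"
proof -
  have n: "R 0 = n" using assms(1) by (simp add: env_def)
  have "holds (coverE (Var 32)) (R(32 := i)) M \<longleftrightarrow> S i" if "i < n" for i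
    using holds_coverE[of "R(32 := i)" M "Var 32"] assms(1) that by simp
  then show ?thesis unfolding rankE_def ev_countE cover_rank_def n
    using assms(2) by (intro arg_cong[where f = card] Collect_cong) auto
qed

lemma ev_rowE: "env R M \<Longrightarrow> R j \<le> k \<Longrightarrow> ev (rowE j) R M = row (R j)"
  by (simp add: rowE_def row_def ev_timesE env_def)

lemma ev_cover_colorE: "env R M \<Longrightarrow> u \<noteq> 32 \<Longrightarrow> ev (cover_colorE u) R M = cover_color (digit R M) (R u)"
  by (simp add: cover_colorE_def cover_color_def ev_digitE ev_rankE env_def[of R])

lemma ev_groupE:
  "env R M \<Longrightarrow> u \<noteq> 32 \<Longrightarrow> R j \<le> k \<Longrightarrow> ev (groupE j u) R M = group (digit R M) (R j) (R u)"
  by (simp add: groupE_def group_def ev_digitE ev_rankE ev_rowE env_def[of R])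

lemma ev_choiceE:
  "env R M \<Longrightarrow> R j \<le> k \<Longrightarrow> ev (choiceE j a) R M = choice_rank (digit R M) (R j) (R a)"
  by (simp add: choiceE_def choice_rank_def ev_digitE ev_rowE env_def[of R])

lemma holds_allowedE:
  assumes "env R M" "R v < n" "j < 31" "v < 31"
  shows "holds (allowedE j v) R M \<longleftrightarrow> allowed (digit R M) (R j) (R v)"
proof -
  have "R 0 = n" using assms by (simp add: env_def)
  then show ?thesis using assms
    by (simp add: allowedE_def allowed_def holds_coverE holds_adjE ev_cover_colorE cong: conj_cong imp_cong)
qed

lemma holds_candidateE:
  assumes "env R M" "R v < n" "R j \<le> k" "j < 31" "a < 31" "v < 31"
  shows "holds (candidateE j a v) R M \<longleftrightarrow> candidate (digit R M) (R j) (R a) (R v)"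
proof -
  have "R 0 = n" using assms by (simp add: env_def)
  then show ?thesis using assms
    by (simp add: candidateE_def candidate_def holds_allowedE holds_coverE holds_adjE ev_groupE)
qed

lemma holds_chosenE:
  assumes "env R M" "R v < n" "R j \<le> k" "j < 30" "a < 30" "v < 30"
  shows "holds (chosenE j a v) R M \<longleftrightarrow> chosen (digit R M) (R j) (R a) (R v)"
proof -
  have n: "R 0 = n" using assms by (simp add: env_def)
  have "{i. i < R 0 \<and> holds (andE (notE (lessE (Var v) (Var 30))) (candidateE j a 30)) (R(30 := i)) M} =
      {w. w < n \<and> w \<le> R v \<and> candidate (digit R M) (R j) (R a) w}"
    by (rule Collect_cong) (use assms in \<open>auto simp: n not_less holds_candidateE\<close>)
  then show ?thesis using assms
    by (simp add: chosenE_def chosen_def holds_candidateE ev_choiceE del: holds_simps(2,1) add: holds_simps(2)[of "candidateE j a v"])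
qed

lemma holds_slotE:
  assumes "env R M" "R v < n" "R j \<le> k" "j < 29" "v < 29"
  shows "holds (slotE v j) R M \<longleftrightarrow> slot_color (digit R M) (R v) (R j)"
proof -
  have "R 3 = l + 1" using assms by (simp add: env_def)
  then show ?thesis using assms by (simp add: slotE_def slot_color_def holds_chosenE)
qed

lemma holds_partialE:
  assumes "env R M" "R v < n" "R j \<le> k" "j < 29" "v < 29"
  shows "holds (partialE v j) R M \<longleftrightarrow> partial_color (digit R M) (R v) (R j)"
  using assms by (simp add: partialE_def partial_color_def holds_slotE holds_coverE ev_cover_colorE)

lemma holds_checkE:
  assumes "env R M"
  shows "holds checkE R M \<longleftrightarrow> check (digit R M)"
proof -
  have "R 0 = n" "R 4 = k" using assms by (simp_all add: env_def)
  then show ?thesis using assms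
    by (simp add: checkE_def check_def holds_partialE holds_slotE holds_coverE holds_adjE
        ev_cover_colorE holds_allowedE cong: conj_cong imp_cong)
qed

end

section \<open>The program\<close>

text \<open>Horner's scheme: \<open>\<delta> 0\<close> is the lowest digit, in front of the number
  obtained for the shifted sequence.\<close>

lemma digits_exist:
  assumes "\<forall>e<L. \<delta> e < (B :: nat)"
  shows "\<exists>g<B ^ L. \<forall>e<L. (g div B ^ e) mod B = \<delta> e"
  using assms
proof (induction L arbitrary: \<delta>)
  case 0
  then show ?case by simp
next
  case (Suc L)
  have "\<forall>e<L. \<delta> (Suc e) < B" using Suc.prems by simp
  from Suc.IH[OF this] obtain g where g: "g < B ^ L" "\<And>e. e < L \<Longrightarrow> (g div B ^ e) mod B = \<delta> (Suc e)"
    by auto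
  have d0: "\<delta> 0 < B" using Suc.prems by simp
  have "\<delta> 0 + B * g < B + B * g" using d0 by simp
  also have "\<dots> = B * Suc g" by simp
  also have "\<dots> \<le> B * B ^ L" using g(1) by (intro mult_le_mono2) simp
  finally have "\<delta> 0 + B * g < B ^ Suc L" by simp
  moreover have "((\<delta> 0 + B * g) div B ^ e) mod B = \<delta> e" if "e < Suc L" for e
  proof (cases e)
    case (Suc e')
    have "(\<delta> 0 + B * g) div B = g" using d0 by simp
    then show ?thesis using g(2)[of e'] that Suc by (simp add: div_mult2_eq)
  qed (use d0 in simp)
  ultimately show ?case by blast
qed

definition freeE :: ex where
  "freeE = andE (adjE 13 16) (notE (coverE (Var 16)))"

text \<open>Greedy step for the vertex in register 13. If it and some neighbor are both unmatched,
  the least such neighbor is found by counting the numbers with no free vertex at or below them.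
  Otherwise the partner is the vertex itself, so that one pair of stores, both writing the value of
  \<open>markE\<close>, handles every case.\<close>

definition partnerE :: ex where
  "partnerE = Cond (coverE (Var 13)) (Var 13) (Cond (exE 16 0 freeE)
     (countE 17 0 (notE (exE 16 0 (andE (notE (lessE (Var 17) (Var 16))) freeE)))) (Var 13))"

definition markE :: ex where
  "markE = orE (coverE (Var 13)) (exE 16 0 freeE)"

definition match_body :: com where
  "match_body = Seq (assign 18 partnerE) (Seq (assign 19 markE)
     (Seq (store (Plus (Var 8) (Var 18)) (Var 19)) (store (Plus (Var 8) (Var 13)) (Var 19))))"

text \<open>The next power is the current one summed as often as the base in register 6
  says.\<close>

definition power_body :: com where
  "power_body = Seq (store (Plus (Var 10) (Var 13)) (Var 11)) (assign 11 (Total 16 6 (Var 11)))"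

definition answerE :: ex where
  "answerE = Cond (lessE (Var 3) (Var 1)) (Lit 0) (Cond (exE 12 7 checkE) (Lit 1) (Lit 0))"

definition prepare :: com where
  "prepare =
     Seq (assign 2 (countE 16 0 (coverE (Var 16))))
    (Seq (assign 3 (Plus (Var 2) (Lit 1)))
    (Seq (assign 4 (Cond (lessE (Var 3) (Var 1)) (Lit 0) (Var 1)))
    (Seq (assign 9 (Plus (Var 2) (Var 3)))
    (Seq (assign 5 (rowE 4))
    (Seq (assign 6 (Plus (Var 5) (Lit 2)))
    (Seq (assign 10 (Plus (Var 8) (Var 0)))
         (assign 11 (Lit 1))))))))"

text \<open>
  Registers: 0 \<open>n\<close>, 1 \<open>k\<close>, 2 \<open>l = |S|\<close>, 3 \<open>l + 1\<close>, 4 the number of colors (0 if \<open>k > l + 1\<close>),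
  5 the number \<open>L\<close> of digits, 6 their base \<open>B\<close>, 7 \<open>B ^ L\<close>, 8 the address of the cover's bit vector,
  9 \<open>2 * l + 1\<close>, 10 the address of the table of powers of \<open>B\<close>, 11 the current power, 12 the guess.
\<close>

definition prog :: com where
  "prog =
     Seq (assign 8 (timesE 0 (Var 0) 0))
    (Seq (for_loop 13 14 0 match_body)
    (Seq prepare
    (Seq (for_loop 13 14 5 power_body)
    (Seq (assign 7 (Var 11))
         (assign 0 answerE)))))"

definition match_time :: "nat \<Rightarrow> nat" where
  "match_time X = (ex_time partnerE X + 2) + ((ex_time markE X + 2) +
     ((ex_time (Plus (Var 8) (Var 18)) X + (ex_time (Var 19) X + 1)) +
      (ex_time (Plus (Var 8) (Var 13)) X + (ex_time (Var 19) X + 1))))"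

definition power_time :: "nat \<Rightarrow> nat" where
  "power_time X = (ex_time (Plus (Var 10) (Var 13)) X + (ex_time (Var 11) X + 1)) +
     (ex_time (Total 16 6 (Var 11)) X + 2)"

definition prepare_time :: "nat \<Rightarrow> nat" where
  "prepare_time X =
     (ex_time (countE 16 0 (coverE (Var 16))) X + 2) +
    ((ex_time (Plus (Var 2) (Lit 1)) X + 2) +
    ((ex_time (Cond (lessE (Var 3) (Var 1)) (Lit 0) (Var 1)) X + 2) +
    ((ex_time (Plus (Var 2) (Var 3)) X + 2) +
    ((ex_time (rowE 4) X + 2) +
    ((ex_time (Plus (Var 5) (Lit 2)) X + 2) +
    ((ex_time (Plus (Var 8) (Var 0)) X + 2) +
     (ex_time (Lit 1) X + 2)))))))"

definition prog_time :: "nat \<Rightarrow> nat" where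
  "prog_time X =
     (ex_time (timesE 0 (Var 0) 0) X + 2) +
    ((10 + X * (match_time X + 14)) +
    (prepare_time X +
    ((10 + X * (power_time X + 14)) +
    ((ex_time (Var 11) X + 2) +
     (ex_time answerE X + 2)))))"

lemma poly_bounded_prog_time: "poly_bounded prog_time"
proof -
  have m: "poly_bounded match_time" unfolding match_time_def[abs_def]
    by (intro poly_bounded_intros poly_bounded_ex_time)
  have p: "poly_bounded power_time" unfolding power_time_def[abs_def]
    by (intro poly_bounded_intros poly_bounded_ex_time)
  have s: "poly_bounded prepare_time" unfolding prepare_time_def[abs_def]
    by (intro poly_bounded_intros poly_bounded_ex_time)
  show ?thesis unfolding prog_time_def[abs_def]
    by (intro poly_bounded_intros poly_bounded_ex_time m p s)
qed

lemma same_regsD: "same_regs R R' \<Longrightarrow> x < 40 \<Longrightarrow> R' x = R x"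
  by (simp add: same_regs_def)

lemma bounded_same_regs: "same_regs R R' \<Longrightarrow> bounded X R \<Longrightarrow> bounded X R'"
  by (auto simp: bounded_def same_regs_def bound_reg_def)

lemma bounded_upd: "bounded X R \<Longrightarrow> (bound_reg x \<Longrightarrow> v \<le> X) \<Longrightarrow> bounded X (R(x := v))"
  by (auto simp: bounded_def)

text \<open>Expresses minimization by counting: the numbers with no solution at or below them are
  exactly those below the least solution.\<close>

lemma card_initial_segment:
  assumes "y < n" "P y" "\<And>z. z < y \<Longrightarrow> \<not> P z"
  shows "card {z. z < n \<and> \<not> (\<exists>x<n. x \<le> z \<and> P x)} = y"
proof -
  have "{z. z < n \<and> \<not> (\<exists>x<n. x \<le> z \<and> P x)} = {..<y}"
    using assms by (auto simp: not_less) (meson le_less_trans not_less)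
  then show ?thesis by simp
qed

section \<open>The vertex cover obtained from a greedy maximal matching\<close>

locale simple_graph =
  fixes n :: nat and E :: "nat \<Rightarrow> nat \<Rightarrow> bool"
  assumes sym: "E u v \<Longrightarrow> E v u" and irrefl: "\<not> E v v" and vert: "E u v \<Longrightarrow> u < n"
begin

lemma cell_less: "u < n \<Longrightarrow> v < n \<Longrightarrow> u * n + v < n * n"
proof -
  assume "u < n" "v < n"
  then have "u * n + v < Suc u * n" by simp
  also have "\<dots> \<le> n * n" using \<open>u < n\<close> by (intro mult_le_mono1) simp
  finally show ?thesis .
qed

definition memory :: "nat set \<Rightarrow> (nat \<Rightarrow> nat) \<Rightarrow> bool" where
  "memory T M \<longleftrightarrow> (\<forall>u<n. \<forall>v<n. M (u * n + v) \<noteq> 0 \<longleftrightarrow> E u v) \<and> (\<forall>u<n. M (n * n + u) \<noteq> 0 \<longleftrightarrow> u \<in> T)"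

text \<open>Every edge whose two ends are added to \<open>T\<close> meets every vertex cover.\<close>

definition half_in_covers :: "nat set \<Rightarrow> bool" where
  "half_in_covers T \<longleftrightarrow> T \<subseteq> {..<n} \<and>
     (\<forall>C. (\<forall>u v. E u v \<longrightarrow> u \<in> C \<or> v \<in> C) \<longrightarrow> card T \<le> 2 * card (T \<inter> C))"

text \<open>The matching itself is not recorded, only what it is good for: at least half of
  \<open>T\<close> lies in every cover, and every edge at a processed vertex meets
  \<open>T\<close>.\<close>

definition match_inv :: "(reg \<Rightarrow> nat) \<Rightarrow> nat \<Rightarrow> (reg \<Rightarrow> nat) \<Rightarrow> (nat \<Rightarrow> nat) \<Rightarrow> bool" where
  "match_inv R0 i R M \<longleftrightarrow> (\<forall>x<12. R x = R0 x) \<and>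
     (\<exists>T. memory T M \<and> half_in_covers T \<and> (\<forall>u<i. \<forall>v. E u v \<longrightarrow> u \<in> T \<or> v \<in> T))"

lemma memory_mark:
  assumes "memory T M" "w < n"
  shows "memory (if f \<noteq> 0 then insert w T else T - {w}) (M(n * n + w := f))"
proof -
  have "u * n + v \<noteq> n * n + w" if "u < n" "v < n" for u v
    using cell_less[OF that] by linarith
  then show ?thesis using assms unfolding memory_def by auto
qed

lemma half_in_covers_insert:
  assumes T: "half_in_covers T" and e: "E u v" and new: "u \<notin> T" "v \<notin> T"
  shows "half_in_covers (insert u (insert v T))"
  unfolding half_in_covers_def
proof (intro conjI allI impI)
  show "insert u (insert v T) \<subseteq> {..<n}"
    using T vert[OF e] vert[OF sym[OF e]] by (auto simp: half_in_covers_def)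
next
  fix C assume C: "\<forall>u v. E u v \<longrightarrow> u \<in> C \<or> v \<in> C"
  have fin: "finite T" using T finite_subset by (auto simp: half_in_covers_def)
  have uv: "u \<noteq> v" using e irrefl by blast
  have 1: "card T \<le> 2 * card (T \<inter> C)" using T C by (simp add: half_in_covers_def)
  have 2: "card (insert u (insert v T)) = card T + 2" using fin new uv by simp
  have "card (T \<inter> C) + 1 \<le> card (insert u (insert v T) \<inter> C)"
  proof -
    obtain w where w: "w \<in> {u, v}" "w \<in> C" using C e by blast
    then have "insert w (T \<inter> C) \<subseteq> insert u (insert v T) \<inter> C" by auto
    moreover have "card (insert w (T \<inter> C)) = card (T \<inter> C) + 1" using fin new w by auto
    ultimately show ?thesis using fin by (metis card_mono finite_Int finite_insert)
  qed
  then show "card (insert u (insert v T)) \<le> 2 * card (insert u (insert v T) \<inter> C)"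
    using 1 2 by linarith
qed

context
  fixes T :: "nat set" and R :: "reg \<Rightarrow> nat" and M :: "nat \<Rightarrow> nat"
  assumes mem: "memory T M" and R: "R 0 = n" "R 8 = n * n" "R 13 < n"
begin

lemma holds_freeE:
  assumes "w < n" "\<forall>x<14. R' x = R x" "R' 16 = w"
  shows "holds freeE R' M \<longleftrightarrow> E (R 13) w \<and> w \<notin> T"
  using assms mem R by (simp add: freeE_def adjE_def coverE_def holds_def[of "Cell _"] ev_timesE memory_def)

lemma ev_coverE_cond: "ev (coverE (Var 13)) R M \<noteq> 0 \<longleftrightarrow> R 13 \<in> T"
  using mem R by (simp add: coverE_def memory_def)

lemma holds_markE: "ev markE R M \<noteq> 0 \<longleftrightarrow> R 13 \<in> T \<or> (\<exists>w<n. E (R 13) w \<and> w \<notin> T)"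
proof -
  have "holds markE R M \<longleftrightarrow> R 13 \<in> T \<or> (\<exists>w<n. E (R 13) w \<and> w \<notin> T)"
    unfolding markE_def using ev_coverE_cond R holds_freeE by (auto simp: holds_def[of "coverE _"])
  then show ?thesis by (simp add: holds_def)
qed

lemma ev_partnerE:
  "R 13 \<in> T \<Longrightarrow> ev partnerE R M = R 13"
  "R 13 \<notin> T \<Longrightarrow> \<not> (\<exists>w<n. E (R 13) w \<and> w \<notin> T) \<Longrightarrow> ev partnerE R M = R 13"
  "R 13 \<notin> T \<Longrightarrow> \<exists>w<n. E (R 13) w \<and> w \<notin> T \<Longrightarrow>
     ev partnerE R M < n \<and> E (R 13) (ev partnerE R M) \<and> ev partnerE R M \<notin> T"
proof -
  have ex: "ev (exE 16 0 freeE) R M \<noteq> 0 \<longleftrightarrow> (\<exists>w<n. E (R 13) w \<and> w \<notin> T)"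
    unfolding holds_def[symmetric] using R holds_freeE by auto
  show "ev partnerE R M = R 13" if "R 13 \<in> T"
    unfolding partnerE_def using that ev_coverE_cond by simp
  show "ev partnerE R M = R 13" if "R 13 \<notin> T" "\<not> (\<exists>w<n. E (R 13) w \<and> w \<notin> T)"
  proof -
    have "ev (coverE (Var 13)) R M = 0" "ev (exE 16 0 freeE) R M = 0"
      using that ev_coverE_cond ex by auto
    then show ?thesis by (simp add: partnerE_def)
  qed
  show "ev partnerE R M < n \<and> E (R 13) (ev partnerE R M) \<and> ev partnerE R M \<notin> T"
    if T: "R 13 \<notin> T" and some: "\<exists>w<n. E (R 13) w \<and> w \<notin> T"
  proof -
    let ?P = "\<lambda>w. E (R 13) w \<and> w \<notin> T"
    define y where "y = (LEAST w. w < n \<and> ?P w)"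
    have least: "y < n \<and> ?P y" unfolding y_def by (rule LeastI_ex) (use some in blast)
    have y: "y < n" "?P y" "\<And>z. z < y \<Longrightarrow> \<not> ?P z"
      using least not_less_Least[of _ "\<lambda>w. w < n \<and> ?P w"] less_trans[of _ y n]
      unfolding y_def[symmetric] by blast+
    have free: "holds freeE (R(17 := i, 16 := x)) M \<longleftrightarrow> ?P x" if "x < n" for i x
      by (rule holds_freeE) (use that in simp_all)
    have "{i. i < R 0 \<and> holds (notE (exE 16 0 (andE (notE (lessE (Var 17) (Var 16))) freeE))) (R(17 := i)) M}
       = {z. z < n \<and> \<not> (\<exists>x<n. x \<le> z \<and> ?P x)}"
      by (rule Collect_cong) (simp add: R(1) not_less free cong: conj_cong)
    then have "ev partnerE R M = y"
      unfolding partnerE_def ev.simps ev_countE using T some ev_coverE_cond ex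
        card_initial_segment[of y n ?P, OF y] by simp
    then show ?thesis using y by simp
  qed
qed

end

lemma runs_match_body:
  assumes inv: "match_inv R0 i R M" and i: "i < n" "R 13 = i"
    and R0: "R0 0 = n" "R0 8 = n * n" and bd: "bounded X R0"
  shows "runs match_body (R, M) (match_time X) (\<lambda>(R', M'). match_inv R0 (Suc i) R' M' \<and> R' 13 = i)"
proof -
  obtain T where T: "memory T M" "half_in_covers T" "\<And>u v. u < i \<Longrightarrow> E u v \<Longrightarrow> u \<in> T \<or> v \<in> T"
    and R: "\<And>x. x < 12 \<Longrightarrow> R x = R0 x"
    using inv unfolding match_inv_def by blast
  have mem: "memory T M" "R 0 = n" "R 8 = n * n" "R 13 < n" using T R R0 i by simp_all
  note partner = ev_partnerE[OF mem]
  have bdR: "bounded X R" by (rule bounded_cong[OF bd]) (use R in simp)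
  let ?w = "ev partnerE R M"
  have w: "?w < n" using partner mem(4) by metis
  have wf: "wf_ex partnerE" "wf_ex markE"
    unfolding partnerE_def markE_def freeE_def macro_defs by (simp_all add: bound_reg_def)
  \<comment> \<open>If \<open>i\<close> already lies in \<open>T\<close>, its partner is
    \<open>i\<close> itself and the insertions change nothing, so one formula covers this case as
    well.\<close>
  define T2 where "T2 = (if i \<in> T \<or> (\<exists>w<n. E i w \<and> w \<notin> T) then insert i (insert ?w T) else T)"
  have M2: "memory T2 (M(n * n + ?w := f, n * n + i := f))"
    if f: "f \<noteq> 0 \<longleftrightarrow> i \<in> T \<or> (\<exists>w<n. E i w \<and> w \<notin> T)" for f
  proof (cases "f = 0")
    case True
    then have none: "i \<notin> T" "\<not> (\<exists>w<n. E i w \<and> w \<notin> T)" using f by auto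
    then have "?w = i" using partner(2) i by simp
    moreover have "T2 = T" unfolding T2_def by (rule if_not_P) (use none in blast)
    ultimately show ?thesis
      using memory_mark[OF memory_mark[OF T(1) w, of 0] i(1), of 0] True none(1) by simp
  next
    case False
    then have "T2 = insert i (insert ?w T)" using f by (auto simp: T2_def)
    then show ?thesis
      using memory_mark[OF memory_mark[OF T(1) w, of f] i(1), of f] False by simp
  qed
  have T2: "half_in_covers T2 \<and> (\<forall>u<Suc i. \<forall>v. E u v \<longrightarrow> u \<in> T2 \<or> v \<in> T2)"
  proof (cases "i \<in> T")
    case True
    then have "T2 = T" using partner(1) i by (auto simp: T2_def)
    then show ?thesis using T True less_antisym by blast
  next
    case False
    show ?thesis
    proof (cases "\<exists>w<n. E i w \<and> w \<notin> T")
      case some: True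
      then have "T2 = insert i (insert ?w T)" by (simp add: T2_def)
      moreover have "half_in_covers (insert i (insert ?w T))"
        using half_in_covers_insert[OF T(2)] partner(3) some False i by auto
      ultimately show ?thesis using T(3) less_antisym by blast
    next
      case none: False
      have "T2 = T" unfolding T2_def by (rule if_not_P) (use none False in blast)
      moreover have "v \<in> T" if "E i v" for v using none that vert[OF sym[OF that]] by blast
      ultimately show ?thesis using T(2,3) by (auto simp: less_Suc_eq)
    qed
  qed
  show ?thesis unfolding match_body_def match_time_def
  proof (rule runs_Seq, rule runs_assign[OF wf(1) _ bdR])
    fix R1 assume R1: "same_regs (R(18 := ?w)) R1"
    have bd1: "bounded X R1"
      by (rule bounded_same_regs[OF R1], rule bounded_upd[OF bdR]) (simp add: bound_reg_def)
    have mem1: "memory T M" "R1 0 = n" "R1 8 = n * n" "R1 13 < n"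
      using mem same_regsD[OF R1] by simp_all
    let ?f = "ev markE R1 M"
    have f: "?f \<noteq> 0 \<longleftrightarrow> i \<in> T \<or> (\<exists>w<n. E i w \<and> w \<notin> T)"
      using holds_markE[OF mem1] same_regsD[OF R1] i by simp
    show "runs (Seq (assign 19 markE) (Seq (store (Plus (Var 8) (Var 18)) (Var 19))
        (store (Plus (Var 8) (Var 13)) (Var 19)))) (R1, M)
       ((ex_time markE X + 2) + ((ex_time (Plus (Var 8) (Var 18)) X + (ex_time (Var 19) X + 1)) +
      (ex_time (Plus (Var 8) (Var 13)) X + (ex_time (Var 19) X + 1))))
       (\<lambda>(R', M'). match_inv R0 (Suc i) R' M' \<and> R' 13 = i)"
    proof (rule runs_Seq, rule runs_assign[OF wf(2) _ bd1])
      fix R2 assume R2: "same_regs (R1(19 := ?f)) R2"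
      have bd2: "bounded X R2"
        by (rule bounded_same_regs[OF R2], rule bounded_upd[OF bd1]) (simp add: bound_reg_def)
      have regs2: "R2 8 = n * n" "R2 18 = ?w" "R2 19 = ?f" "R2 13 = i"
        "\<And>x. x < 12 \<Longrightarrow> R2 x = R0 x"
        using same_regsD[OF R1] same_regsD[OF R2] R R0 i by simp_all
      show "runs (Seq (store (Plus (Var 8) (Var 18)) (Var 19)) (store (Plus (Var 8) (Var 13)) (Var 19)))
         (R2, M) ((ex_time (Plus (Var 8) (Var 18)) X + (ex_time (Var 19) X + 1)) +
        (ex_time (Plus (Var 8) (Var 13)) X + (ex_time (Var 19) X + 1)))
         (\<lambda>(R', M'). match_inv R0 (Suc i) R' M' \<and> R' 13 = i)"
      proof (rule runs_Seq, rule runs_store[OF _ _ bd2])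
        fix R3 assume R3: "same_regs R2 R3"
        have M1: "M(ev (Plus (Var 8) (Var 18)) R2 M := ev (Var 19) R2 M) = M(n * n + ?w := ?f)"
          using regs2 by simp
        show "runs (store (Plus (Var 8) (Var 13)) (Var 19))
           (R3, M(ev (Plus (Var 8) (Var 18)) R2 M := ev (Var 19) R2 M))
           (ex_time (Plus (Var 8) (Var 13)) X + (ex_time (Var 19) X + 1))
           (\<lambda>(R', M'). match_inv R0 (Suc i) R' M' \<and> R' 13 = i)"
          unfolding M1
        proof (rule runs_store[OF _ _ bounded_same_regs[OF R3 bd2]])
          fix R4 assume R4: "same_regs R3 R4"
          have "R4 13 = i" "\<forall>x<12. R4 x = R0 x"
            using same_regsD[OF R3] same_regsD[OF R4] regs2 by simp_all
          moreover have "R3 8 = n * n" "R3 13 = i" "R3 19 = ?f"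
            using same_regsD[OF R3] regs2 by simp_all
          ultimately show "case (R4, (M(n * n + ?w := ?f))(ev (Plus (Var 8) (Var 13)) R3 (M(n * n + ?w := ?f)) :=
              ev (Var 19) R3 (M(n * n + ?w := ?f)))) of
              (R', M') \<Rightarrow> match_inv R0 (Suc i) R' M' \<and> R' 13 = i"
            using M2[OF f] T2 unfolding match_inv_def by auto
        qed simp_all
      qed simp_all
    qed simp
  qed simp
qed

end

section \<open>Correctness of the program\<close>

context simple_graph
begin

lemma runs_matching:
  assumes R: "R 0 = n" "R 8 = n * n" and mem: "memory {} M" and bd: "bounded X R"
    and Q: "\<And>R' M' T. (\<And>x. x < 12 \<Longrightarrow> R' x = R x) \<Longrightarrow> memory T M' \<Longrightarrow> half_in_covers T \<Longrightarrow>
      (\<And>u v. E u v \<Longrightarrow> u \<in> T \<or> v \<in> T) \<Longrightarrow> Q (R', M')"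
  shows "runs (for_loop 13 14 0 match_body) (R, M) (10 + X * (match_time X + 14)) Q"
proof (rule runs_for_loop[where I = "match_inv R" and N = n])
  show "bounded X R' \<and> R' 0 = n" if "match_inv R i R' M'" for i R' M'
    using that R by (auto simp: match_inv_def intro: bounded_cong[OF bd])
  show "match_inv R i R'' M'" if "match_inv R i R' M'"
    "\<And>z. z < 40 \<Longrightarrow> z \<noteq> 13 \<Longrightarrow> z \<noteq> 14 \<Longrightarrow> R'' z = R' z" for i R' R'' M'
    using that by (auto simp: match_inv_def)
  show "runs match_body (R', M') (match_time X) (\<lambda>(R', M'). match_inv R (Suc i) R' M' \<and> R' 13 = i)"
    if "i < n" "match_inv R i R' M'" "R' 13 = i" for i R' M'
    by (rule runs_match_body[OF that(2,1,3) R bd])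
  show "match_inv R 0 R M"
    using mem by (auto simp: match_inv_def half_in_covers_def)
  show "n \<le> X" using bd R by (auto simp: bounded_def bound_reg_def)
  show "Q (R', M')" if "match_inv R n R' M'" for R' M'
    using that Q vert unfolding match_inv_def by blast
qed simp_all

text \<open>Register 4 bounds sums, while the input \<open>k\<close> may be arbitrarily large. For
  \<open>k > l + 1\<close> the answer is no anyway, and the harmless value 0 keeps the number of
  digits bounded in terms of \<open>l\<close>.\<close>

definition color_reg :: "nat \<Rightarrow> nat \<Rightarrow> nat" where
  "color_reg l k = (if l + 1 < k then 0 else k)"

lemma runs_prepare:
  assumes R: "R 0 = n" "R 1 = k" "R 8 = n * n" and mem: "memory T M" "T \<subseteq> {..<n}"
    and l: "l = card T" and kk: "kk = color_reg l k" and L: "L = slots.row l kk"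
    and bd: "bounded X R" and X: "l + 1 \<le> X" "L + 2 \<le> X"
    and Q: "\<And>R'. R' 0 = n \<Longrightarrow> R' 1 = k \<Longrightarrow> R' 2 = l \<Longrightarrow> R' 3 = l + 1 \<Longrightarrow> R' 4 = kk \<Longrightarrow> R' 5 = L \<Longrightarrow>
      R' 6 = L + 2 \<Longrightarrow> R' 8 = n * n \<Longrightarrow> R' 9 = 2 * l + 1 \<Longrightarrow> R' 10 = n * n + n \<Longrightarrow> R' 11 = 1 \<Longrightarrow>
      bounded X R' \<Longrightarrow> Q (R', M)"
  shows "runs prepare (R, M) (prepare_time X) Q"
proof -
  have row: "slots.row l kk = l + kk * (2 * l + 1)" by (simp add: slots.row_def)
  have kX: "kk \<le> X" "l \<le> X" "L \<le> X" using X by (auto simp: kk color_reg_def)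
  have wf: "wf_ex (countE 16 0 (coverE (Var 16)))" "wf_ex (rowE 4)"
    "wf_ex (Cond (lessE (Var 3) (Var 1)) (Lit 0) (Var 1))"
    unfolding macro_defs by (simp_all add: bound_reg_def)
  have bd_step: "bounded X R2" if "bounded X R1" "same_regs (R1(x := v)) R2" "v \<le> X \<or> x \<ge> 8" for R1 R2 x v
    using bounded_same_regs[OF that(2)] bounded_upd[OF that(1), of x v] that(3)
    by (auto simp: bound_reg_def)
  show ?thesis unfolding prepare_def prepare_time_def
  proof (rule runs_Seq, rule runs_assign[OF wf(1) _ bd])
    fix R1 assume R1: "same_regs (R(2 := ev (countE 16 0 (coverE (Var 16))) R M)) R1"
    have "{i. i < R 0 \<and> holds (coverE (Var 16)) (R(16 := i)) M} = T"
      using mem R by (auto simp: coverE_def holds_def memory_def)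
    then have e1: "ev (countE 16 0 (coverE (Var 16))) R M = l" by (simp add: l)
    have v1: "R1 0 = n" "R1 1 = k" "R1 2 = l" "R1 8 = n * n"
      using same_regsD[OF R1] R e1 by simp_all
    have b1: "bounded X R1" using bd_step[OF bd R1] e1 kX by simp
    show "runs (Seq (assign 3 (Plus (Var 2) (Lit 1)))
      (Seq (assign 4 (Cond (lessE (Var 3) (Var 1)) (Lit 0) (Var 1)))
      (Seq (assign 9 (Plus (Var 2) (Var 3))) (Seq (assign 5 (rowE 4))
      (Seq (assign 6 (Plus (Var 5) (Lit 2))) (Seq (assign 10 (Plus (Var 8) (Var 0))) (assign 11 (Lit 1))))))))
      (R1, M) ((ex_time (Plus (Var 2) (Lit 1)) X + 2) +
       ((ex_time (Cond (lessE (Var 3) (Var 1)) (Lit 0) (Var 1)) X + 2) +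
       ((ex_time (Plus (Var 2) (Var 3)) X + 2) + ((ex_time (rowE 4) X + 2) +
       ((ex_time (Plus (Var 5) (Lit 2)) X + 2) + ((ex_time (Plus (Var 8) (Var 0)) X + 2) +
       (ex_time (Lit 1) X + 2))))))) Q"
    proof (rule runs_Seq, rule runs_assign[OF _ _ b1])
      fix R2 assume R2: "same_regs (R1(3 := ev (Plus (Var 2) (Lit 1)) R1 M)) R2"
      have v2: "R2 0 = n" "R2 1 = k" "R2 2 = l" "R2 3 = l + 1" "R2 8 = n * n"
        using same_regsD[OF R2] v1 by simp_all
      have b2: "bounded X R2" using bd_step[OF b1 R2] v1 X by simp
      show "runs (Seq (assign 4 (Cond (lessE (Var 3) (Var 1)) (Lit 0) (Var 1)))
        (Seq (assign 9 (Plus (Var 2) (Var 3))) (Seq (assign 5 (rowE 4))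
        (Seq (assign 6 (Plus (Var 5) (Lit 2))) (Seq (assign 10 (Plus (Var 8) (Var 0))) (assign 11 (Lit 1)))))))
        (R2, M) ((ex_time (Cond (lessE (Var 3) (Var 1)) (Lit 0) (Var 1)) X + 2) +
         ((ex_time (Plus (Var 2) (Var 3)) X + 2) + ((ex_time (rowE 4) X + 2) +
         ((ex_time (Plus (Var 5) (Lit 2)) X + 2) + ((ex_time (Plus (Var 8) (Var 0)) X + 2) +
         (ex_time (Lit 1) X + 2)))))) Q"
      proof (rule runs_Seq, rule runs_assign[OF wf(3) _ b2])
        fix R3 assume R3: "same_regs (R2(4 := ev (Cond (lessE (Var 3) (Var 1)) (Lit 0) (Var 1)) R2 M)) R3"
        have e3: "ev (Cond (lessE (Var 3) (Var 1)) (Lit 0) (Var 1)) R2 M = kk"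
          using v2 by (simp add: kk color_reg_def lessE_def)
        have v3: "R3 0 = n" "R3 1 = k" "R3 2 = l" "R3 3 = l + 1" "R3 4 = kk" "R3 8 = n * n"
          using same_regsD[OF R3] v2 e3 by simp_all
        have b3: "bounded X R3" using bd_step[OF b2 R3] e3 kX by simp
        show "runs (Seq (assign 9 (Plus (Var 2) (Var 3))) (Seq (assign 5 (rowE 4))
          (Seq (assign 6 (Plus (Var 5) (Lit 2))) (Seq (assign 10 (Plus (Var 8) (Var 0))) (assign 11 (Lit 1))))))
          (R3, M) ((ex_time (Plus (Var 2) (Var 3)) X + 2) + ((ex_time (rowE 4) X + 2) +
           ((ex_time (Plus (Var 5) (Lit 2)) X + 2) + ((ex_time (Plus (Var 8) (Var 0)) X + 2) +
           (ex_time (Lit 1) X + 2))))) Q"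
        proof (rule runs_Seq, rule runs_assign[OF _ _ b3])
          fix R4 assume R4: "same_regs (R3(9 := ev (Plus (Var 2) (Var 3)) R3 M)) R4"
          have v4: "R4 0 = n" "R4 1 = k" "R4 2 = l" "R4 3 = l + 1" "R4 4 = kk" "R4 8 = n * n"
            "R4 9 = 2 * l + 1"
            using same_regsD[OF R4] v3 by simp_all
          have b4: "bounded X R4" using bd_step[OF b3 R4] by simp
          show "runs (Seq (assign 5 (rowE 4)) (Seq (assign 6 (Plus (Var 5) (Lit 2)))
            (Seq (assign 10 (Plus (Var 8) (Var 0))) (assign 11 (Lit 1)))))
            (R4, M) ((ex_time (rowE 4) X + 2) + ((ex_time (Plus (Var 5) (Lit 2)) X + 2) +
             ((ex_time (Plus (Var 8) (Var 0)) X + 2) + (ex_time (Lit 1) X + 2)))) Q"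
          proof (rule runs_Seq, rule runs_assign[OF wf(2) _ b4])
            fix R5 assume R5: "same_regs (R4(5 := ev (rowE 4) R4 M)) R5"
            have e5: "ev (rowE 4) R4 M = L"
              using v4 by (simp add: rowE_def ev_timesE L row)
            have v5: "R5 0 = n" "R5 1 = k" "R5 2 = l" "R5 3 = l + 1" "R5 4 = kk" "R5 5 = L"
              "R5 8 = n * n" "R5 9 = 2 * l + 1"
              using same_regsD[OF R5] v4 e5 by simp_all
            have b5: "bounded X R5" using bd_step[OF b4 R5] e5 kX by simp
            show "runs (Seq (assign 6 (Plus (Var 5) (Lit 2)))
              (Seq (assign 10 (Plus (Var 8) (Var 0))) (assign 11 (Lit 1))))
              (R5, M) ((ex_time (Plus (Var 5) (Lit 2)) X + 2) +
               ((ex_time (Plus (Var 8) (Var 0)) X + 2) + (ex_time (Lit 1) X + 2))) Q"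
            proof (rule runs_Seq, rule runs_assign[OF _ _ b5])
              fix R6 assume R6: "same_regs (R5(6 := ev (Plus (Var 5) (Lit 2)) R5 M)) R6"
              have v6: "R6 0 = n" "R6 1 = k" "R6 2 = l" "R6 3 = l + 1" "R6 4 = kk" "R6 5 = L"
                "R6 6 = L + 2" "R6 8 = n * n" "R6 9 = 2 * l + 1"
                using same_regsD[OF R6] v5 by simp_all
              have b6: "bounded X R6" using bd_step[OF b5 R6] v5 X by simp
              show "runs (Seq (assign 10 (Plus (Var 8) (Var 0))) (assign 11 (Lit 1)))
                (R6, M) ((ex_time (Plus (Var 8) (Var 0)) X + 2) + (ex_time (Lit 1) X + 2)) Q"
              proof (rule runs_Seq, rule runs_assign[OF _ _ b6])
                fix R7 assume R7: "same_regs (R6(10 := ev (Plus (Var 8) (Var 0)) R6 M)) R7"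
                have b7: "bounded X R7" using bd_step[OF b6 R7] by simp
                show "runs (assign 11 (Lit 1)) (R7, M) (ex_time (Lit 1) X + 2) Q"
                proof (rule runs_assign[OF _ _ b7])
                  fix R8 assume R8: "same_regs (R7(11 := ev (Lit 1) R7 M)) R8"
                  have b8: "bounded X R8" using bd_step[OF b7 R8] by simp
                  show "Q (R8, M)"
                    by (rule Q) (use same_regsD[OF R8] same_regsD[OF R7] v6 b8 in simp_all)
                qed simp_all
              qed simp_all
            qed simp_all
          qed simp
        qed simp_all
      qed simp
    qed simp_all
  qed simp
qed

text \<open>The table starts right after the adjacency matrix and the cover vector; the last clause
  says that both survive.\<close>

definition power_inv ::
  "(reg \<Rightarrow> nat) \<Rightarrow> (nat \<Rightarrow> nat) \<Rightarrow> nat \<Rightarrow> (reg \<Rightarrow> nat) \<Rightarrow> (nat \<Rightarrow> nat) \<Rightarrow> bool" where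
  "power_inv R0 M0 i R M \<longleftrightarrow> (\<forall>x<11. R x = R0 x) \<and> R 11 = R0 6 ^ i \<and>
     (\<forall>e<i. M (R0 10 + e) = R0 6 ^ e) \<and> (\<forall>a<R0 10. M a = M0 a)"

lemma runs_powers:
  assumes R: "R 5 = L" "R 11 = 1" and bd: "bounded X R"
    and Q: "\<And>R' M'. (\<And>x. x < 11 \<Longrightarrow> R' x = R x) \<Longrightarrow> R' 11 = R 6 ^ L \<Longrightarrow>
      (\<And>e. e < L \<Longrightarrow> M' (R 10 + e) = R 6 ^ e) \<Longrightarrow> (\<And>a. a < R 10 \<Longrightarrow> M' a = M a) \<Longrightarrow> Q (R', M')"
  shows "runs (for_loop 13 14 5 power_body) (R, M) (10 + X * (power_time X + 14)) Q"
proof (rule runs_for_loop[where I = "power_inv R M" and N = L])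
  have bd': "bounded X R'" if "\<And>x. x < 11 \<Longrightarrow> R' x = R x" for R'
    using bd that by (auto simp: bounded_def bound_reg_def)
  show "bounded X R' \<and> R' 5 = L" if "power_inv R M i R' M'" for i R' M'
    using that R bd' by (auto simp: power_inv_def)
  show "power_inv R M i R'' M'" if "power_inv R M i R' M'"
    "\<And>z. z < 40 \<Longrightarrow> z \<noteq> 13 \<Longrightarrow> z \<noteq> 14 \<Longrightarrow> R'' z = R' z" for i R' R'' M'
    using that by (auto simp: power_inv_def)
  show "runs power_body (R', M') (power_time X) (\<lambda>(R', M'). power_inv R M (Suc i) R' M' \<and> R' 13 = i)"
    if i: "i < L" and inv: "power_inv R M i R' M'" and R13: "R' 13 = i" for i R' M'
  proof -
    have v: "\<And>x. x < 11 \<Longrightarrow> R' x = R x" "R' 11 = R 6 ^ i" "\<And>e. e < i \<Longrightarrow> M' (R 10 + e) = R 6 ^ e"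
      "\<And>a. a < R 10 \<Longrightarrow> M' a = M a"
      using inv by (auto simp: power_inv_def)
    show ?thesis unfolding power_body_def power_time_def
    proof (rule runs_Seq, rule runs_store[OF _ _ bd'])
      fix R1 assume R1: "same_regs R' R1"
      show "runs (assign 11 (Total 16 6 (Var 11)))
         (R1, M'(ev (Plus (Var 10) (Var 13)) R' M' := ev (Var 11) R' M'))
         (ex_time (Total 16 6 (Var 11)) X + 2) (\<lambda>(R', M'). power_inv R M (Suc i) R' M' \<and> R' 13 = i)"
      proof (rule runs_assign[OF _ _ bd'])
        fix R2
        let ?M1 = "M'(ev (Plus (Var 10) (Var 13)) R' M' := ev (Var 11) R' M')"
        assume R2: "same_regs (R1(11 := ev (Total 16 6 (Var 11)) R1 ?M1)) R2"
        have "ev (Total 16 6 (Var 11)) R1 ?M1 = R 6 ^ Suc i"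
          using same_regsD[OF R1] v by simp
        then show "case (R2, ?M1) of (R', M') \<Rightarrow> power_inv R M (Suc i) R' M' \<and> R' 13 = i"
          using same_regsD[OF R1] same_regsD[OF R2] v R13
          by (auto simp: power_inv_def less_Suc_eq)
      qed (use same_regsD[OF R1] v in \<open>simp_all add: bound_reg_def\<close>)
    qed (use v in simp_all)
  qed
  show "power_inv R M 0 R M" using R by (simp add: power_inv_def)
  show "L \<le> X" using bd R by (auto simp: bounded_def bound_reg_def)
  show "Q (R', M')" if "power_inv R M L R' M'" for R' M'
    using that by (intro Q) (auto simp: power_inv_def)
qed simp_all

lemma covered:
  assumes "\<And>u v. E u v \<Longrightarrow> u \<in> T \<or> v \<in> T" "T \<subseteq> {..<n}"
  shows "covered_graph n (card T) E (\<lambda>u. u \<in> T)"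
proof
  show "card T = card {u. u < n \<and> u \<in> T}" using assms(2) by (intro arg_cong[where f = card]) auto
qed (use sym vert assms(1) in auto)

lemma ev_answerE:
  assumes T: "half_in_covers T" "\<And>u v. E u v \<Longrightarrow> u \<in> T \<or> v \<in> T" and mem: "memory T M"
    and l: "l = card T" and kk: "kk = color_reg l k" and L: "L = slots.row l kk"
    and R: "R 0 = n" "R 1 = k" "R 2 = l" "R 3 = l + 1" "R 4 = kk" "R 6 = L + 2" "R 7 = (L + 2) ^ L"
      "R 8 = n * n" "R 9 = 2 * l + 1" "R 10 = n * n + n"
    and pow: "\<And>e. e < L \<Longrightarrow> M (n * n + n + e) = (L + 2) ^ e"
  shows "ev answerE R M = (if \<exists>c. slots.b_color_fun n k E c then 1 else 0)"
proof -
  have Tn: "T \<subseteq> {..<n}" using T(1) by (simp add: half_in_covers_def)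
  interpret cg: covered_graph n k l E "\<lambda>u. u \<in> T" unfolding l by (rule covered[OF T(2) Tn])
  show ?thesis
  proof (cases "l + 1 < k")
    case True
    then show ?thesis using cg.b_color_fun_few_colors R by (auto simp: answerE_def lessE_def)
  next
    case False
    then have kk: "kk = k" by (simp add: kk color_reg_def)
    have env: "cg.env (R(12 := g)) M" if "g < R 7" for g
      using that R kk mem by (simp add: cg.env_def memory_def)
    have "holds (exE 12 7 checkE) R M \<longleftrightarrow> (\<exists>g<R 7. cg.check (digit (R(12 := g)) M))"
      using cg.holds_checkE[OF env] by auto
    also have "\<dots> \<longleftrightarrow> (\<exists>c. slots.b_color_fun n k E c)"
    proof
      assume "\<exists>g<R 7. cg.check (digit (R(12 := g)) M)"
      then show "\<exists>c. slots.b_color_fun n k E c" using cg.check_sound by blast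
    next
      assume "\<exists>c. slots.b_color_fun n k E c"
      then obtain \<delta> where \<delta>: "\<forall>e. \<delta> e < L + 2" "\<And>\<delta>'. (\<forall>e<L. \<delta>' e = \<delta> e) \<Longrightarrow> cg.check \<delta>'"
        using cg.check_complete unfolding L kk by blast
      then obtain g where g: "g < (L + 2) ^ L" "\<forall>e<L. (g div (L + 2) ^ e) mod (L + 2) = \<delta> e"
        using digits_exist[of L \<delta> "L + 2"] by blast
      \<comment> \<open>From position \<open>L\<close> on the table is not filled and the decoded
        digits are arbitrary; \<open>check_complete\<close> tolerates this.\<close>
      have "digit (R(12 := g)) M e = \<delta> e" if "e < L" for e
        using g(2) that pow R by (simp add: digit_def)
      then show "\<exists>g<R 7. cg.check (digit (R(12 := g)) M)" using \<delta>(2) g(1) R by metis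
    qed
    finally show ?thesis using False R by (simp add: answerE_def lessE_def holds_def)
  qed
qed

end

section \<open>The number of guesses and the run of the whole program\<close>

lemma row_mono: "l \<le> l' \<Longrightarrow> j \<le> j' \<Longrightarrow> slots.row l j \<le> slots.row l' j'"
  unfolding slots.row_def by (intro add_mono mult_le_mono) auto

text \<open>This is \<open>row\<close> for the worst case allowed by a cover of size
  \<open>m\<close>: \<open>l = 2 * m\<close> and \<open>k = 2 * m + 1\<close>.\<close>

definition max_digits :: "nat \<Rightarrow> nat" where
  "max_digits m = 2 * m + (2 * m + 1) * (4 * m + 1)"

text \<open>The extra 1 in the exponent makes this a bound for the base as well as for the number of
  guesses, even when there are no digits; registers 6 and 7 both have to stay within it.\<close>

definition guesses :: "nat \<Rightarrow> nat" where
  "guesses m = (max_digits m + 2) ^ (max_digits m + 1)"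

context simple_graph
begin

text \<open>The cover \<open>C\<close> need not be the computed one: only its size enters, through
  \<open>card T \<le> 2 * card C\<close>. This fixes one bound \<open>?X\<close> for all loop bounds
  before the run starts.\<close>

lemma runs_prog:
  assumes R: "R 0 = n" "R 1 = k" "\<And>x. x > 1 \<Longrightarrow> R x = 0" and mem: "memory {} M"
    and C: "\<And>u v. E u v \<Longrightarrow> u \<in> C \<or> v \<in> C" "finite C"
  shows "runs prog (R, M) (prog_time (n + guesses (card C)))
    (\<lambda>s. fst s 0 = (if \<exists>c. slots.b_color_fun n k E c then 1 else 0))"
proof -
  let ?X = "n + guesses (card C)"
  let ?Q = "\<lambda>s. fst s 0 = (if \<exists>c. slots.b_color_fun n k E c then 1 else 0)"
  have "R b = (if b = 0 then n else if b = 1 then k else 0)" for b using R by auto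
  then have bd: "bounded ?X R" by (simp add: bounded_def bound_reg_def)
  have wf: "wf_ex answerE" "wf_ex (timesE 0 (Var 0) 0)"
    unfolding answerE_def timesE_def lessE_def exE_def using wf_checkE by (simp_all add: bound_reg_def)
  have e8: "ev (timesE 0 (Var 0) 0) R M = n * n" using R by (simp add: ev_timesE)
  show ?thesis unfolding prog_def prog_time_def
  proof (rule runs_Seq, rule runs_assign[OF wf(2) _ bd])
    fix R1 assume R1: "same_regs (R(8 := ev (timesE 0 (Var 0) 0) R M)) R1"
    have v1: "R1 0 = n" "R1 1 = k" "R1 8 = n * n" "R1 7 = 0" using same_regsD[OF R1] R e8 by simp_all
    have b1: "bounded ?X R1"
      by (rule bounded_same_regs[OF R1], rule bounded_upd[OF bd]) (simp add: bound_reg_def)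
    show "runs (Seq (for_loop 13 14 0 match_body) (Seq prepare (Seq (for_loop 13 14 5 power_body)
        (Seq (assign 7 (Var 11)) (assign 0 answerE))))) (R1, M)
      ((10 + ?X * (match_time ?X + 14)) + (prepare_time ?X + ((10 + ?X * (power_time ?X + 14)) +
       ((ex_time (Var 11) ?X + 2) + (ex_time answerE ?X + 2))))) ?Q"
    proof (rule runs_Seq, rule runs_matching[OF v1(1,3) mem b1])
      fix R2 M2 T assume R2: "\<And>x. x < 12 \<Longrightarrow> R2 x = R1 x" and mem2: "memory T M2"
        and T: "half_in_covers T" "\<And>u v. E u v \<Longrightarrow> u \<in> T \<or> v \<in> T"
      define l where "l = card T"
      define kk where "kk = color_reg l k"
      define L where "L = slots.row l kk"
      have Tn: "T \<subseteq> {..<n}" using T(1) by (simp add: half_in_covers_def)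
      have "card (T \<inter> C) \<le> card C" using C(2) by (intro card_mono) auto
      then have l2: "l \<le> 2 * card C" using T(1) C(1) unfolding half_in_covers_def l_def
        by (meson le_trans mult_le_mono2)
      have kk2: "kk \<le> 2 * card C + 1" using l2 by (auto simp: kk_def color_reg_def)
      have "L \<le> slots.row (2 * card C) (2 * card C + 1)" unfolding L_def by (rule row_mono[OF l2 kk2])
      then have L2: "L \<le> max_digits (card C)"
        by (simp add: slots.row_def max_digits_def algebra_simps)
      have "(L + 2) ^ (L + 1) \<le> (max_digits (card C) + 2) ^ (L + 1)"
        using L2 by (intro power_mono) auto
      also have "\<dots> \<le> guesses (card C)" unfolding guesses_def
        using L2 by (intro power_increasing) auto
      finally have pL: "(L + 2) ^ (L + 1) \<le> guesses (card C)" .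
      have pw: "(L + 2) ^ L \<le> (L + 2) ^ (L + 1)" "(L + 2) ^ 1 \<le> (L + 2) ^ (L + 1)"
        by (intro power_increasing; simp)+
      have X: "(L + 2) ^ L \<le> ?X" "L + 2 \<le> ?X" using pL pw by simp_all
      have "l \<le> L" by (simp add: L_def slots.row_def)
      then have X': "l + 1 \<le> ?X" using X(2) by simp
      have v2: "R2 0 = n" "R2 1 = k" "R2 8 = n * n" using R2 v1 by simp_all
      have b2: "bounded ?X R2" by (rule bounded_cong[OF b1]) (use R2 in simp)
      show "runs (Seq prepare (Seq (for_loop 13 14 5 power_body)
          (Seq (assign 7 (Var 11)) (assign 0 answerE)))) (R2, M2)
        (prepare_time ?X + ((10 + ?X * (power_time ?X + 14)) +
         ((ex_time (Var 11) ?X + 2) + (ex_time answerE ?X + 2)))) ?Q"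
      proof (rule runs_Seq, rule runs_prepare[OF v2 mem2 Tn l_def kk_def L_def b2 X' X(2)])
        fix R3 assume v3: "R3 0 = n" "R3 1 = k" "R3 2 = l" "R3 3 = l + 1" "R3 4 = kk" "R3 5 = L"
          "R3 6 = L + 2" "R3 8 = n * n" "R3 9 = 2 * l + 1" "R3 10 = n * n + n" "R3 11 = 1"
          and b3: "bounded ?X R3"
        show "runs (Seq (for_loop 13 14 5 power_body) (Seq (assign 7 (Var 11)) (assign 0 answerE)))
          (R3, M2) ((10 + ?X * (power_time ?X + 14)) +
           ((ex_time (Var 11) ?X + 2) + (ex_time answerE ?X + 2))) ?Q"
        proof (rule runs_Seq, rule runs_powers[OF v3(6,11) b3])
          fix R4 M4 assume R4: "\<And>x. x < 11 \<Longrightarrow> R4 x = R3 x" "R4 11 = R3 6 ^ L"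
            and M4: "\<And>e. e < L \<Longrightarrow> M4 (R3 10 + e) = R3 6 ^ e" "\<And>a. a < R3 10 \<Longrightarrow> M4 a = M2 a"
          have b4: "bounded ?X R4" using b3 R4(1) by (auto simp: bounded_def bound_reg_def)
          have mem4: "memory T M4"
          proof -
            have "M4 (u * n + v) = M2 (u * n + v)" if "u < n" "v < n" for u v
              using M4(2) v3 cell_less[OF that] by simp
            moreover have "M4 (n * n + u) = M2 (n * n + u)" if "u < n" for u
              using M4(2) v3 that by simp
            ultimately show ?thesis using mem2 by (simp add: memory_def)
          qed
          show "runs (Seq (assign 7 (Var 11)) (assign 0 answerE)) (R4, M4)
            ((ex_time (Var 11) ?X + 2) + (ex_time answerE ?X + 2)) ?Q"
          proof (rule runs_Seq, rule runs_assign[OF _ _ b4])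
            fix R5 assume R5: "same_regs (R4(7 := ev (Var 11) R4 M4)) R5"
            have b5: "bounded ?X R5"
              by (rule bounded_same_regs[OF R5], rule bounded_upd[OF b4])
                (use R4(2) v3 X(1) in simp)
            show "runs (assign 0 answerE) (R5, M4) (ex_time answerE ?X + 2) ?Q"
            proof (rule runs_assign[OF wf(1) _ b5])
              fix R6 assume R6: "same_regs (R5(0 := ev answerE R5 M4)) R6"
              have "ev answerE R5 M4 = (if \<exists>c. slots.b_color_fun n k E c then 1 else 0)"
                by (rule ev_answerE[OF T mem4 l_def kk_def L_def])
                  (use same_regsD[OF R5] R4 v3 M4(1) in simp_all)
              then show "?Q (R6, M4)" using same_regsD[OF R6] by simp
            qed simp
          qed simp_all
        qed
      qed
    qed
  qed simp
qed

end

text \<open>Classes are numbered from 1 and colors from 0, so class \<open>Suc i\<close> corresponds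
  to color \<open>i\<close>. Disjointness of the classes makes the color of a vertex unique.\<close>

lemma b_coloring_iff_color_fun:
  assumes G: "pair_graph G" and n: "pverts G = {..<n}"
  shows "(\<exists>C. b_coloring G k C) \<longleftrightarrow> (\<exists>c. slots.b_color_fun n k (\<lambda>u v. (u, v) \<in> parcs G) c)"
proof
  interpret pair_graph G by (rule G)
  have vert: "u < n \<and> v < n" if "(u, v) \<in> parcs G" for u v
    using in_arcsD1[OF that] in_arcsD2[OF that] n by auto
  {
    assume "\<exists>C. b_coloring G k C"
    then obtain C where C: "(\<Union>i\<in>{1..k}. C i) = {..<n}" "disjoint_family_on C {1..k}"
      "\<And>i. i \<in> {1..k} \<Longrightarrow> independent_set G (C i)"
      "\<And>i. i \<in> {1..k} \<Longrightarrow> \<exists>v\<in>C i. \<forall>j\<in>{1..k} - {i}. \<exists>w\<in>C j. (v, w) \<in> parcs G"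
      by (auto simp: b_coloring_def proper_coloring_def coloring_def n)
    define c where "c v = (SOME i. i < k \<and> v \<in> C (Suc i))" for v
    have c: "c v < k \<and> v \<in> C (Suc (c v))" if "v < n" for v
    proof -
      obtain i where "i \<in> {1..k}" "v \<in> C i" using C(1) \<open>v < n\<close> by blast
      then have "i - 1 < k \<and> v \<in> C (Suc (i - 1))" by auto
      then show ?thesis unfolding c_def by (rule someI)
    qed
    have c_eq: "c v = i" if "v \<in> C (Suc i)" "i < k" "v < n" for v i
      using C(2) c[OF that(3)] that unfolding disjoint_family_on_def
      by (metis IntI One_nat_def Suc_le_eq atLeastAtMost_iff empty_iff le_add1 nat.inject plus_1_eq_Suc)
    have Cn: "v < n" if "v \<in> C (Suc i)" "i < k" for v i
      using C(1) that by (metis One_nat_def Suc_le_eq UN_I atLeastAtMost_iff le_add1 lessThan_iff plus_1_eq_Suc)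
    have "slots.b_color_fun n k (\<lambda>u v. (u, v) \<in> parcs G) c"
      unfolding slots.b_color_fun_def
    proof (intro conjI allI impI)
      show "c v < k" if "v < n" for v using c[OF that] by simp
      show "c u \<noteq> c v" if "(u, v) \<in> parcs G" for u v
        using c[of u] c[of v] vert[OF that] C(3)[of "Suc (c u)"] that
        by (auto simp: independent_set_def)
      fix j assume j: "j < k"
      then obtain v where v: "v \<in> C (Suc j)"
        "\<And>i. i \<in> {1..k} - {Suc j} \<Longrightarrow> \<exists>w\<in>C i. (v, w) \<in> parcs G"
        using C(4)[of "Suc j"] by auto
      have "\<exists>w<n. (v, w) \<in> parcs G \<and> c w = i" if i: "i < k" "i \<noteq> j" for i
        using v(2)[of "Suc i"] i Cn c_eq by fastforce
      then show "\<exists>v<n. c v = j \<and> (\<forall>i<k. i \<noteq> j \<longrightarrow> (\<exists>w<n. (v, w) \<in> parcs G \<and> c w = i))"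
        using Cn[OF v(1) j] c_eq[OF v(1) j] by blast
    qed
    then show "\<exists>c. slots.b_color_fun n k (\<lambda>u v. (u, v) \<in> parcs G) c" by blast
  next
    assume "\<exists>c. slots.b_color_fun n k (\<lambda>u v. (u, v) \<in> parcs G) c"
    then obtain c where c: "\<And>v. v < n \<Longrightarrow> c v < k" "\<And>u v. (u, v) \<in> parcs G \<Longrightarrow> c u \<noteq> c v"
      "\<And>j. j < k \<Longrightarrow> \<exists>v<n. c v = j \<and> (\<forall>i<k. i \<noteq> j \<longrightarrow> (\<exists>w<n. (v, w) \<in> parcs G \<and> c w = i))"
      unfolding slots.b_color_fun_def by blast
    define C where "C i = {v. v < n \<and> Suc (c v) = i}" for i
    have "coloring G k C"
      using c(1) by (auto simp: coloring_def n C_def disjoint_family_on_def Suc_le_eq)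
    moreover have "independent_set G (C i)" for i
      using c(2) by (fastforce simp: independent_set_def C_def n)
    moreover have "\<exists>v\<in>C i. \<forall>j\<in>{1..k} - {i}. \<exists>w\<in>C j. (v, w) \<in> parcs G" if i: "i \<in> {1..k}" for i
    proof -
      have "i - 1 < k" using i by auto
      from c(3)[OF this] obtain v where v: "v < n" "c v = i - 1"
        "\<And>j. j < k \<Longrightarrow> j \<noteq> i - 1 \<Longrightarrow> \<exists>w<n. (v, w) \<in> parcs G \<and> c w = j"
        by blast
      have "\<exists>w\<in>C j. (v, w) \<in> parcs G" if j: "j \<in> {1..k} - {i}" for j
      proof -
        have "j - 1 < k" "j - 1 \<noteq> i - 1" using i j by auto
        from v(3)[OF this] show ?thesis using j by (auto simp: C_def)
      qed
      moreover have "v \<in> C i" using v i by (auto simp: C_def)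
      ultimately show ?thesis by blast
    qed
    ultimately show "\<exists>C. b_coloring G k C" unfolding b_coloring_def proper_coloring_def by blast
  }
qed

lemma prog_decides:
  assumes G: "pair_graph G" and n: "pverts G = {..<n}"
  shows "\<exists>t. halts_with prog (input_state G k) t (\<exists>C. b_coloring G k C) \<and>
    t \<le> prog_time (n + guesses (vertex_cover_number G))"
proof -
  interpret pair_graph G by (rule G)
  let ?E = "\<lambda>u v. (u, v) \<in> parcs G"
  interpret simple_graph n ?E
  proof
    show "?E v u" if "?E u v" for u v using arcs_symmetric[OF that] .
    show "\<not> ?E v v" for v using pair_no_loops[of "(v, v)"] by auto
    show "u < n" if "?E u v" for u v using in_arcsD1[OF that] n by auto
  qed
  let ?covers = "{card S | S. vertex_cover G S}"
  have "vertex_cover G (pverts G)" by (simp add: vertex_cover_def independent_set_def)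
  then have "?covers \<noteq> {}" by blast
  moreover have "finite ?covers"
    by (rule finite_subset[of _ "card ` Pow {..<n}"]) (auto simp: vertex_cover_def n)
  ultimately have "vertex_cover_number G \<in> ?covers"
    unfolding vertex_cover_number_def using Min_in by blast
  then obtain C where C: "vertex_cover G C" "card C = vertex_cover_number G" by auto
  have cov: "u \<in> C \<or> v \<in> C" if "?E u v" for u v
    using C(1) that in_arcsD1[OF that] in_arcsD2[OF that]
    by (auto simp: vertex_cover_def independent_set_def)
  have fin: "finite C" using C(1) n finite_subset by (auto simp: vertex_cover_def)
  define R where "R = (\<lambda>_ :: nat. 0 :: nat)(0 := n, 1 := k)"
  define M where "M = (\<lambda>a. if a < n * n \<and> (a div n, a mod n) \<in> parcs G then 1 else 0 :: nat)"
  have RM: "input_state G k = (R, M)"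
    unfolding input_state_def n R_def M_def Let_def card_lessThan by (rule refl)
  have R: "R 0 = n" "R 1 = k" "\<And>x. x > 1 \<Longrightarrow> R x = 0" by (simp_all add: R_def)
  have mem: "memory {} M"
    unfolding memory_def M_def
  proof (intro conjI allI impI)
    fix u v assume uv: "u < n" "v < n"
    then have "(u * n + v) div n = u" "(u * n + v) mod n = v" by simp_all
    then show "((if u * n + v < n * n \<and> ((u * n + v) div n, (u * n + v) mod n) \<in> parcs G then 1 else 0)
        \<noteq> (0 :: nat)) = ((u, v) \<in> parcs G)" using cell_less[OF uv] by simp
  qed simp
  from runs_prog[OF R mem cov fin, unfolded C(2)] show ?thesis
    unfolding runs_def halts_with_def RM b_coloring_iff_color_fun[OF G n] by blast
qed

theorem mainTheorem3:
  shows "\<exists>(p :: com) (f :: nat \<Rightarrow> real) (q :: nat \<Rightarrow> real) (d :: nat).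
    f \<in> O(\<lambda>l. real l ^ 2 * log 2 (real l)) \<and>
    q \<in> O(\<lambda>n. real n ^ d) \<and>
    (\<forall>(n :: nat) (G :: nat pair_pre_digraph) (k :: nat).
      pair_graph G \<and> pverts G = {..<n} \<longrightarrow>
      (\<exists>t. halts_with p (input_state G k) t (\<exists>C. b_coloring G k C) \<and>
           real t \<le> 2 powr f (vertex_cover_number G) * q n))"
proof -
  obtain K D where KD: "\<And>X. prog_time X \<le> K * (X + 1) ^ D"
    using poly_bounded_prog_time unfolding poly_bounded_def by blast
  \<comment> \<open>This is \<open>D\<close> times the binary logarithm of \<open>guesses l\<close>.
    It may be positive at \<open>l = 0\<close> and \<open>l = 1\<close>, where
    \<open>l ^ 2 * log 2 l\<close> vanishes, since the growth bound is only eventual.\<close>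
  define f where "f l = real D * ((real (max_digits l) + 1) * log 2 (real (max_digits l) + 2))" for l
  define q where "q n = real K * (real n + 2) ^ D" for n
  have "(\<lambda>l. (real (max_digits l) + 1) * log 2 (real (max_digits l) + 2))
      \<in> O(\<lambda>l. real l ^ 2 * log 2 (real l))"
    unfolding max_digits_def by simp real_asymp
  then have f: "f \<in> O(\<lambda>l. real l ^ 2 * log 2 (real l))"
    unfolding f_def by (cases "D = 0") simp_all
  have "(\<lambda>n. real n + 2) \<in> O(\<lambda>n. real n)" by real_asymp
  then have "(\<lambda>n. (real n + 2) ^ D) \<in> O(\<lambda>n. real n ^ D)" by (rule landau_o.big_power)
  then have q: "q \<in> O(\<lambda>n. real n ^ D)" unfolding q_def by (cases "K = 0") simp_all
  have bound: "real (prog_time (n + guesses l)) \<le> 2 powr f l * q n" for n l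
  proof -
    have g1: "1 \<le> guesses l" unfolding guesses_def by (rule one_le_power) simp
    \<comment> \<open>Because \<open>guesses l\<close> is at least 1, the sum is bounded by a
      product, which separates the parameter from \<open>n\<close>.\<close>
    have "n + guesses l + 1 \<le> (n + 2) * guesses l"
      using mult_le_mono2[OF g1, of "n + 1"] by (simp add: algebra_simps)
    then have "K * (n + guesses l + 1) ^ D \<le> K * ((n + 2) * guesses l) ^ D"
      by (intro mult_le_mono2 power_mono) auto
    then have "prog_time (n + guesses l) \<le> K * ((n + 2) * guesses l) ^ D"
      using KD le_trans by blast
    then have "real (prog_time (n + guesses l)) \<le> real (K * ((n + 2) * guesses l) ^ D)"
      by (simp only: of_nat_le_iff)
    also have "\<dots> = q n * real (guesses l) ^ D"
      by (simp only: q_def power_mult_distrib of_nat_mult of_nat_power of_nat_add of_nat_numeral mult.assoc)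
    also have "real (guesses l) = 2 powr ((real (max_digits l) + 1) * log 2 (real (max_digits l) + 2))"
    proof -
      have "2 powr ((real (max_digits l) + 1) * log 2 (real (max_digits l) + 2)) =
          (2 powr log 2 (real (max_digits l) + 2)) powr (real (max_digits l + 1))"
        by (simp only: powr_powr of_nat_add of_nat_1 mult.commute)
      also have "\<dots> = (real (max_digits l) + 2) ^ (max_digits l + 1)"
        by (subst powr_realpow) simp_all
      finally show ?thesis by (simp only: guesses_def of_nat_power of_nat_add of_nat_numeral)
    qed
    also have "(2 powr ((real (max_digits l) + 1) * log 2 (real (max_digits l) + 2))) ^ D = 2 powr f l"
      by (simp add: f_def powr_power)
    finally show ?thesis by (simp add: mult.commute)
  qed
  have "\<exists>t. halts_with prog (input_state G k) t (\<exists>C. b_coloring G k C) \<and>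
      real t \<le> 2 powr f (vertex_cover_number G) * q n"
    if "pair_graph G" "pverts G = {..<n}" for n G k
    using prog_decides[OF that, of k] bound[of n "vertex_cover_number G"]
    by (meson le_trans of_nat_le_iff order_trans)
  then show ?thesis using f q by blast
qed

end
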